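(* Let $q$ and $b$ be integers such that $q\ge 2$, $q$ divides $b$, and $b/q\ge 2$. Let $\tau:\Sigma_q^\ast\to\{-1,0,\ldots,b-2\}$ be a maximal tree mapping satisfying $$\mathcal D_\tau:=\sup\{\mathcal D_{\tau,\delta}:\ \delta\in\Sigma_q^\ast\}<\infty .$$ Then for any integer $K$ coprime with $b$, the set $K\Lambda(\tau)=\{K\lambda:\lambda\in\Lambda(\tau)\}$ is a spectrum of the Cantor measure $\mu_{q,b}$ if and only if it is a maximal orthogonal set of $\mu_{q,b}$.
   Context: Cantor measure: $\mu_{q,b}$ is the unique Borel probability measure on $\mathbb R$ with $\mu_{q,b}=\frac1q\sum_{i=0}^{q-1}\mu_{q,b}(f_i^{-1}(\cdot))$, where $f_i(x)=x/b+i/q$, $0\le i\le q-1$. A countable set $\Lambda\subset\mathbb R$ is a spectrum of a probability measure $\mu$ if $\{e^{-2\pi i\lambda x}:\lambda\in\Lambda\}$ is an orthogonal basis of $L^2(\mu)$. It is an orthogonal set of $\mu$ if the functions $e^{-2\pi i\lambda x}$, $\lambda\in\Lambda$, are pairwise orthogonal in $L^2(\mu)$, and a maximal orthogonal set if moreover no $\Lambda\cup\{\lambda_0\}$ with $\lambda_0\in\mathbb R\setminus\Lambda$ is an orthogonal set of $\mu$. Words: $\Sigma_q=\{0,1,\ldots,q-1\}$; $\Sigma_q^n$ is the set of words of length $n$ over $\Sigma_q$; $\Sigma_q^\ast=\bigcup_{1\le n<\infty}\Sigma_q^n$; $\Sigma_q^\infty$ is the set of infinite words. Juxtaposition denotes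 concatenation; $0^k$ is the word of $k$ zeros and $0^\infty=000\cdots$. For $k\ge1$, $\delta|_k$ is the prefix of length $k$ of $\delta$ if $\delta\in\Sigma_q^\infty$, and the prefix of length $k$ of $\delta0^\infty$ if $\delta\in\Sigma_q^\ast$. Tree mapping: a map $\tau:\Sigma_q^\ast\to\{-1,0,\ldots,b-2\}$ with (i) $\tau(0^n)=0$ for all $n\ge1$; (ii) $\tau(\delta)\in\delta_n+q\mathbb Z$ for every $\delta=\delta_1\cdots\delta_n\in\Sigma_q^n$, $n\ge1$. It is maximal if (iii) for any $\delta\in\Sigma_q^\ast$ there exists $\delta'\in\Sigma_q^\ast$ such that $\tau((\delta\delta')|_n)=0$ for all sufficiently large $n$. $\Lambda(\tau):=\{\sum_{n=1}^\infty\tau(\delta|_n)b^{n-1}:\ \delta\in\Sigma_q^\ast\text{ such that }\tau(\delta|_m)=0\text{ for all sufficiently large }m\}$. Level difference: for $\delta,\delta'\in\Sigma_q^\ast$ put $A_\delta(\delta')=\{m\ge1:\tau(\delta(\delta'|_m))\ne0\}$ and $B_\delta(\delta')=\{m\ge1:\tau(\delta(\delta'|_m))\notin q\mathbb Z\}$; enumerate $A_\delta(\delta')=\{n_j:j\ge1\}$ in strictly increasing order and put $n_0=0$. Then $$\mathcal D_{\tau,\delta}(\delta')=\#A_\delta(\delta')+\sum_{n_j\in B_\delta(\delta')}(n_j-n_{j-1}-1),$$ (with value $\infty$ if $A_\delta(\delta')$ is infinite), and $\mathcal D_{\tau,\delta}:=\inf\{\mathcal D_{\tau,\delta}(\delta'):\delta'\in\Sigma_q^\ast\}$.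 *)

theory Defs
  imports "HOL-Probability.Probability" "HOL-Library.Extended_Nat"
begin

section \<open>The Cantor measure\<close>

definition cantor_map :: "nat \<Rightarrow> nat \<Rightarrow> nat \<Rightarrow> real \<Rightarrow> real" where
  "cantor_map q b i x = x / real b + real i / real q"

definition is_cantor_measure :: "nat \<Rightarrow> nat \<Rightarrow> real measure \<Rightarrow> bool" where
  "is_cantor_measure q b \<mu> \<longleftrightarrow>
     prob_space \<mu> \<and> sets \<mu> = sets borel \<and>
     (\<forall>A\<in>sets borel.
        measure \<mu> A = (1 / real q) * (\<Sum>i = 0..q - 1. measure \<mu> (cantor_map q b i -` A)))"

text \<open>The description is proper for all parameters \<open>q \<ge> 1\<close>, \<open>b \<ge> 2\<close>: see
  \<open>cantor_measure_ex1\<close> below.\<close>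

definition cantor_measure :: "nat \<Rightarrow> nat \<Rightarrow> real measure" where
  "cantor_measure q b = (THE \<mu>. is_cantor_measure q b \<mu>)"


section \<open>Spectra and orthogonal sets\<close>

definition expo :: "real \<Rightarrow> real \<Rightarrow> complex" where
  "expo l x = exp (- 2 * of_real pi * \<i> * of_real l * of_real x)"

definition square_integrable :: "real measure \<Rightarrow> (real \<Rightarrow> complex) \<Rightarrow> bool" where
  "square_integrable \<mu> f \<longleftrightarrow>
     f \<in> borel_measurable \<mu> \<and> integrable \<mu> (\<lambda>x. (cmod (f x))\<^sup>2)"

definition L2_inner :: "real measure \<Rightarrow> (real \<Rightarrow> complex) \<Rightarrow> (real \<Rightarrow> complex) \<Rightarrow> complex" where
  "L2_inner \<mu> f g = (\<integral>x. f x * cnj (g x) \<partial>\<mu>)"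

definition orthogonal_set :: "real measure \<Rightarrow> real set \<Rightarrow> bool" where
  "orthogonal_set \<mu> \<Lambda> \<longleftrightarrow> countable \<Lambda> \<and>
     (\<forall>l\<in>\<Lambda>. \<forall>l'\<in>\<Lambda>. l \<noteq> l' \<longrightarrow> L2_inner \<mu> (expo l) (expo l') = 0)"

definition maximal_orthogonal_set :: "real measure \<Rightarrow> real set \<Rightarrow> bool" where
  "maximal_orthogonal_set \<mu> \<Lambda> \<longleftrightarrow> orthogonal_set \<mu> \<Lambda> \<and>
     (\<forall>l0. l0 \<notin> \<Lambda> \<longrightarrow> \<not> orthogonal_set \<mu> (insert l0 \<Lambda>))"

text \<open>An orthogonal basis of a Hilbert space is an orthogonal family of nonzero vectors whose
  linear span is dense.  Functions are used in place of their almost-everywhere classes; the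
  exponentials have modulus 1, so they are nonzero in \<open>L\<^sup>2(\<mu>)\<close>.\<close>

definition is_spectrum :: "real measure \<Rightarrow> real set \<Rightarrow> bool" where
  "is_spectrum \<mu> \<Lambda> \<longleftrightarrow> orthogonal_set \<mu> \<Lambda> \<and>
     (\<forall>f. square_integrable \<mu> f \<longrightarrow>
       (\<forall>\<epsilon>>0. \<exists>F c. finite F \<and> F \<subseteq> \<Lambda> \<and>
          (\<integral>x. (cmod (f x - (\<Sum>l\<in>F. c l * expo l x)))\<^sup>2 \<partial>\<mu>) < \<epsilon>))"


section \<open>Words and tree mappings\<close>

text \<open>A finite word is the list of its letters.\<close>

definition words :: "nat \<Rightarrow> nat list set" where
  "words q = {\<delta>. \<delta> \<noteq> [] \<and> set \<delta> \<subseteq> {0..<q}}"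

text \<open>The prefix of length \<open>k\<close> of \<open>\<delta>\<close> continued by infinitely many zeros.\<close>

definition word_prefix :: "nat list \<Rightarrow> nat \<Rightarrow> nat list" where
  "word_prefix \<delta> k = take k (\<delta> @ replicate k 0)"

text \<open>A tree mapping is a total function on lists here; its values outside \<open>words q\<close>
  are unconstrained and never used.\<close>

definition tree_mapping :: "nat \<Rightarrow> nat \<Rightarrow> (nat list \<Rightarrow> int) \<Rightarrow> bool" where
  "tree_mapping q b \<tau> \<longleftrightarrow>
     (\<forall>\<delta>\<in>words q. \<tau> \<delta> \<in> {-1..int b - 2}) \<and>
     (\<forall>n\<ge>1. \<tau> (replicate n 0) = 0) \<and>
     (\<forall>\<delta>\<in>words q. \<exists>k. \<tau> \<delta> = int (last \<delta>) + int q * k)"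

definition maximal_tree_mapping :: "nat \<Rightarrow> nat \<Rightarrow> (nat list \<Rightarrow> int) \<Rightarrow> bool" where
  "maximal_tree_mapping q b \<tau> \<longleftrightarrow> tree_mapping q b \<tau> \<and>
     (\<forall>\<delta>\<in>words q. \<exists>\<delta>'\<in>words q.
        eventually (\<lambda>n. \<tau> (word_prefix (\<delta> @ \<delta>') n) = 0) sequentially)"

definition tree_Lambda :: "nat \<Rightarrow> nat \<Rightarrow> (nat list \<Rightarrow> int) \<Rightarrow> real set" where
  "tree_Lambda q b \<tau> =
     {(\<Sum>n. of_int (\<tau> (word_prefix \<delta> (Suc n))) * real b ^ n) | \<delta>.
        \<delta> \<in> words q \<and> eventually (\<lambda>m. \<tau> (word_prefix \<delta> m) = 0) sequentially}"


section \<open>The level difference\<close>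

definition level_A :: "(nat list \<Rightarrow> int) \<Rightarrow> nat list \<Rightarrow> nat list \<Rightarrow> nat set" where
  "level_A \<tau> \<delta> \<delta>' = {m. m \<ge> 1 \<and> \<tau> (\<delta> @ word_prefix \<delta>' m) \<noteq> 0}"

definition level_B :: "nat \<Rightarrow> (nat list \<Rightarrow> int) \<Rightarrow> nat list \<Rightarrow> nat list \<Rightarrow> nat set" where
  "level_B q \<tau> \<delta> \<delta>' = {m. m \<ge> 1 \<and> \<not> int q dvd \<tau> (\<delta> @ word_prefix \<delta>' m)}"

text \<open>The list \<open>ns\<close> is \<open>n\<^sub>0 = 0, n\<^sub>1, n\<^sub>2, \<dots>\<close>; it is strictly increasing, so the
  subtraction of natural numbers does not truncate.\<close>

definition level_diff_at ::
  "nat \<Rightarrow> (nat list \<Rightarrow> int) \<Rightarrow> nat list \<Rightarrow> nat list \<Rightarrow> enat" where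
  "level_diff_at q \<tau> \<delta> \<delta>' =
     (let A = level_A \<tau> \<delta> \<delta>'; B = level_B q \<tau> \<delta> \<delta>' in
      if finite A then
        let ns = 0 # sorted_list_of_set A in
        enat (card A +
          (\<Sum>j | 1 \<le> j \<and> j \<le> card A \<and> ns ! j \<in> B. ns ! j - ns ! (j - 1) - 1))
      else \<infinity>)"

definition level_diff_from :: "nat \<Rightarrow> (nat list \<Rightarrow> int) \<Rightarrow> nat list \<Rightarrow> enat" where
  "level_diff_from q \<tau> \<delta> = (INF \<delta>'\<in>words q. level_diff_at q \<tau> \<delta> \<delta>')"

definition level_diff :: "nat \<Rightarrow> (nat list \<Rightarrow> int) \<Rightarrow> enat" where
  "level_diff q \<tau> = (SUP \<delta>\<in>words q. level_diff_from q \<tau> \<delta>)"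


section \<open>Existence and uniqueness of the Cantor measure\<close>

lemma cantor_map_measurable [measurable]: "cantor_map q b i \<in> borel_measurable borel"
  unfolding cantor_map_def by measurable

lemma cantor_measure_exists:
  assumes q: "q \<ge> 1" and b: "b \<ge> 2"
  shows "\<exists>\<mu>. is_cantor_measure q b \<mu>"
proof -
  define p where "p = measure_pmf (pmf_of_set {0..q - 1})"
  define S where "S = stream_space p"
  define X where "X \<omega> = (\<Sum>k. real (\<omega> !! k mod q) / (real q * real b ^ k))" for \<omega>
  interpret p: prob_space p unfolding p_def by (rule prob_space_measure_pmf)
  interpret S: prob_space S unfolding S_def by (rule p.prob_space_stream_space)
  have [measurable_cong]: "sets p = sets (count_space UNIV)" by (simp add: p_def)
  have X [measurable]: "X \<in> borel_measurable S" unfolding X_def S_def by measurable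
  have summ: "summable (\<lambda>k. real (\<omega> !! k mod q) / (real q * real b ^ k))" for \<omega>
  proof (rule summable_comparison_test)
    show "summable (\<lambda>k. (1 / real b) ^ k)" using b by (intro summable_geometric) simp
    have "real (\<omega> !! k mod q) \<le> real q" for k
      using q by (simp add: less_imp_le)
    then show "\<exists>N. \<forall>k\<ge>N. norm (real (\<omega> !! k mod q) / (real q * real b ^ k)) \<le> (1 / real b) ^ k"
      using q b by (auto simp: field_simps power_divide)
  qed
  have step: "X (i ## \<omega>) = cantor_map q b i (X \<omega>)" if "i < q" for i \<omega>
  proof -
    have "X (i ## \<omega>) = real (i mod q) / real q
        + (\<Sum>k. real (\<omega> !! k mod q) / (real q * real b ^ Suc k))"
      using suminf_split_head[OF summ[of "i ## \<omega>"]] by (simp add: X_def)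
    also have "(\<Sum>k. real (\<omega> !! k mod q) / (real q * real b ^ Suc k)) = X \<omega> / real b"
      unfolding X_def by (subst suminf_divide[OF summ, symmetric]) (simp add: mult_ac)
    finally show ?thesis using that by (simp add: cantor_map_def)
  qed
  define \<mu> where "\<mu> = distr S borel X"
  interpret \<mu>: prob_space \<mu> unfolding \<mu>_def by (rule S.prob_space_distr) simp
  have "measure \<mu> A = (1 / real q) * (\<Sum>i = 0..q - 1. measure \<mu> (cantor_map q b i -` A))"
    if A [measurable]: "A \<in> sets borel" for A
  proof -
    have sp: "space S = UNIV" by (simp add: S_def space_stream_space p_def)
    have m: "cantor_map q b i -` A \<in> sets borel" for i
      using measurable_sets[OF cantor_map_measurable[of q b i] A] by simp
    have XA: "X -` A \<in> sets (stream_space p)"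
      using measurable_sets[OF X A] sp by (simp add: S_def)
    have "emeasure \<mu> A = emeasure S (X -` A)"
      unfolding \<mu>_def using sp by (simp add: emeasure_distr)
    also have "\<dots> = (\<integral>\<^sup>+i. emeasure S {\<omega>\<in>space S. i ## \<omega> \<in> X -` A} \<partial>p)"
      unfolding S_def by (rule p.emeasure_stream_space[OF XA])
    also have "\<dots> = (\<Sum>i = 0..q - 1. emeasure S {\<omega>\<in>space S. i ## \<omega> \<in> X -` A}) / real q"
      unfolding p_def using q
      by (subst nn_integral_pmf_of_set) (auto simp: ennreal_of_nat_eq_real_of_nat)
    also have "(\<Sum>i = 0..q - 1. emeasure S {\<omega>\<in>space S. i ## \<omega> \<in> X -` A})
        = (\<Sum>i = 0..q - 1. emeasure \<mu> (cantor_map q b i -` A))"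
    proof (rule sum.cong)
      fix i assume "i \<in> {0..q - 1}"
      then have i: "i < q" using q by auto
      have "emeasure \<mu> (cantor_map q b i -` A) = emeasure S (X -` (cantor_map q b i -` A))"
        unfolding \<mu>_def using sp m by (simp add: emeasure_distr)
      then show "emeasure S {\<omega>\<in>space S. i ## \<omega> \<in> X -` A} = emeasure \<mu> (cantor_map q b i -` A)"
        using step[OF i] sp by (simp add: vimage_def)
    qed simp
    finally show ?thesis
      using q by (simp add: \<mu>.emeasure_eq_measure sum_nonneg divide_ennreal)
  qed
  then have "is_cantor_measure q b \<mu>"
    unfolding is_cantor_measure_def using \<mu>.prob_space_axioms by (simp add: \<mu>_def)
  then show ?thesis by blast
qed

lemma is_cantor_measure_char:
  assumes q: "q \<ge> 1" and \<mu>: "is_cantor_measure q b \<mu>"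
  shows "char \<mu> t = (\<Sum>i = 0..q - 1. iexp (t * (real i / real q))) / of_nat q * char \<mu> (t / real b)"
proof -
  define p where "p = measure_pmf (pmf_of_set {0..q - 1})"
  interpret p: prob_space p unfolding p_def by (rule prob_space_measure_pmf)
  interpret \<mu>: prob_space \<mu> using \<mu> by (simp add: is_cantor_measure_def)
  interpret P: pair_prob_space p \<mu> ..
  have [measurable_cong]: "sets p = sets (count_space UNIV)" by (simp add: p_def)
  have s [measurable_cong]: "sets \<mu> = sets borel" using \<mu> by (simp add: is_cantor_measure_def)
  have sp: "space \<mu> = UNIV" using sets_eq_imp_space_eq[OF s] by simp
  define g where "g = (\<lambda>(i, x). cantor_map q b i x)"
  have g [measurable]: "g \<in> borel_measurable (p \<Otimes>\<^sub>M \<mu>)"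
    unfolding g_def cantor_map_def by measurable
  have eq: "\<mu> = distr (p \<Otimes>\<^sub>M \<mu>) borel g"
  proof (rule measure_eqI)
    fix A assume "A \<in> sets \<mu>"
    then have A [measurable]: "A \<in> sets borel" by (simp add: s)
    have "emeasure (distr (p \<Otimes>\<^sub>M \<mu>) borel g) A
        = emeasure (p \<Otimes>\<^sub>M \<mu>) (g -` A \<inter> space (p \<Otimes>\<^sub>M \<mu>))"
      by (simp add: emeasure_distr)
    also have "\<dots> = (\<integral>\<^sup>+i. emeasure \<mu> (Pair i -` (g -` A \<inter> space (p \<Otimes>\<^sub>M \<mu>))) \<partial>p)"
      by (rule \<mu>.emeasure_pair_measure_alt) simp
    also have "\<dots> = (\<integral>\<^sup>+i. emeasure \<mu> (cantor_map q b i -` A) \<partial>p)"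
      by (intro nn_integral_cong arg_cong[where f = "emeasure \<mu>"])
         (auto simp: g_def space_pair_measure sp p_def)
    also have "\<dots> = (\<Sum>i = 0..q - 1. emeasure \<mu> (cantor_map q b i -` A)) / real q"
      unfolding p_def using q
      by (subst nn_integral_pmf_of_set) (auto simp: ennreal_of_nat_eq_real_of_nat)
    also have "\<dots> = ennreal ((1 / real q) * (\<Sum>i = 0..q - 1. measure \<mu> (cantor_map q b i -` A)))"
      using q by (simp add: \<mu>.emeasure_eq_measure sum_nonneg divide_ennreal)
    also have "\<dots> = emeasure \<mu> A"
      using \<mu> A by (simp add: \<mu>.emeasure_eq_measure is_cantor_measure_def)
    finally show "emeasure \<mu> A = emeasure (distr (p \<Otimes>\<^sub>M \<mu>) borel g) A" ..
  qed (simp add: s)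
  have int: "integrable (p \<Otimes>\<^sub>M \<mu>) (\<lambda>z. iexp (t * g z))"
    by (rule P.P.integrable_const_bound[where B = 1]) auto
  have "char \<mu> t = (\<integral>z. iexp (t * g z) \<partial>(p \<Otimes>\<^sub>M \<mu>))"
    unfolding char_def by (subst eq, subst integral_distr) auto
  also have "\<dots> = (\<integral>i. (\<integral>x. iexp (t * g (i, x)) \<partial>\<mu>) \<partial>p)"
    using P.integral_fst'[OF int] by simp
  also have "\<dots> = (\<integral>i. iexp (t * (real i / real q)) * char \<mu> (t / real b) \<partial>p)"
  proof (rule Bochner_Integration.integral_cong)
    fix i
    have "(\<integral>x. iexp (t * g (i, x)) \<partial>\<mu>)
        = (\<integral>x. iexp (t * (real i / real q)) * iexp (t / real b * x) \<partial>\<mu>)"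
      by (intro Bochner_Integration.integral_cong)
         (auto simp: g_def cantor_map_def exp_add[symmetric] algebra_simps)
    then show "(\<integral>x. iexp (t * g (i, x)) \<partial>\<mu>) = iexp (t * (real i / real q)) * char \<mu> (t / real b)"
      by (simp add: char_def)
  qed simp
  also have "\<dots> = (\<Sum>i = 0..q - 1. iexp (t * (real i / real q))) / of_nat q * char \<mu> (t / real b)"
    unfolding p_def using q
    by (subst integral_measure_pmf[of "{0..q - 1}"])
       (auto simp: sum_distrib_right sum_divide_distrib scaleR_conv_of_real)
  finally show ?thesis .
qed

lemma is_cantor_measure_unique:
  assumes q: "q \<ge> 1" and b: "b \<ge> 2"
    and \<mu>: "is_cantor_measure q b \<mu>" and \<nu>: "is_cantor_measure q b \<nu>"
  shows "\<mu> = \<nu>"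
proof -
  interpret \<mu>: real_distribution \<mu>
    using \<mu> by (auto simp: is_cantor_measure_def real_distribution_def
        real_distribution_axioms_def dest: sets_eq_imp_space_eq)
  interpret \<nu>: real_distribution \<nu>
    using \<nu> by (auto simp: is_cantor_measure_def real_distribution_def
        real_distribution_axioms_def dest: sets_eq_imp_space_eq)
  define d where "d t = char \<mu> t - char \<nu> t" for t
  have le: "norm (d t) \<le> norm (d (t / real b))" for t
  proof -
    let ?m = "(\<Sum>i = 0..q - 1. iexp (t * (real i / real q))) / of_nat q"
    have "norm (\<Sum>i = 0..q - 1. iexp (t * (real i / real q))) \<le> (\<Sum>i = 0..q - 1. 1)"
      by (intro sum_norm_le) simp
    also have "\<dots> = real q" using q by simp
    finally have m: "norm ?m \<le> 1" using q by (simp add: norm_divide)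
    have "d t = ?m * d (t / real b)"
      unfolding d_def
      by (subst is_cantor_measure_char[OF q \<mu>], subst is_cantor_measure_char[OF q \<nu>])
         (simp add: right_diff_distrib)
    then have "norm (d t) = norm ?m * norm (d (t / real b))" by (metis norm_mult)
    also have "\<dots> \<le> 1 * norm (d (t / real b))"
      by (rule mult_right_mono[OF m]) simp
    finally show ?thesis by simp
  qed
  have le_pow: "norm (d t) \<le> norm (d (t / real b ^ n))" for t n
  proof (induction n)
    case (Suc n)
    then show ?case using le[of "t / real b ^ n"] by (simp add: mult.commute)
  qed simp
  have "d t = 0" for t
  proof -
    have "(\<lambda>n. t * inverse (real b) ^ n) \<longlonglongrightarrow> t * 0"
      using b by (intro tendsto_intros LIMSEQ_realpow_zero) (auto simp: inverse_eq_divide)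
    then have "(\<lambda>n. t / real b ^ n) \<longlonglongrightarrow> 0" by (simp add: field_simps power_inverse)
    moreover have "isCont d 0"
      unfolding d_def by (intro continuous_intros \<mu>.isCont_char \<nu>.isCont_char)
    ultimately have "(\<lambda>n. d (t / real b ^ n)) \<longlonglongrightarrow> d 0" by (metis isCont_tendsto_compose)
    then have "(\<lambda>n. norm (d (t / real b ^ n))) \<longlonglongrightarrow> norm (d 0)" by (rule tendsto_norm)
    then have "norm (d t) \<le> norm (d 0)"
      using le_pow by (intro LIMSEQ_le_const) auto
    also have "d 0 = 0" by (simp add: d_def \<mu>.char_zero \<nu>.char_zero)
    finally show ?thesis by simp
  qed
  then have "char \<mu> = char \<nu>" by (auto simp: d_def fun_eq_iff)
  then show ?thesis
    using Levy_uniqueness \<mu>.real_distribution_axioms \<nu>.real_distribution_axioms by blast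
qed

lemma cantor_measure_ex1:
  assumes "q \<ge> 1" and "b \<ge> 2"
  shows "\<exists>!\<mu>. is_cantor_measure q b \<mu>"
  using cantor_measure_exists is_cantor_measure_unique assms by blast

lemma is_cantor_measure_cantor_measure:
  assumes "q \<ge> 1" and "b \<ge> 2"
  shows "is_cantor_measure q b (cantor_measure q b)"
  unfolding cantor_measure_def by (rule theI'[OF cantor_measure_ex1[OF assms]])

end

theory Submission
  imports Defs
begin

text \<open>Write \<open>H = |\<mu>^|\<^sup>2\<close> and \<open>m\<close> for the squared modulus of the mask, so that
  \<open>H(x) = m(x) H(x/b)\<close>.  For fixed \<open>\<xi>\<close> the numbers \<open>m(\<xi> + \<dots>)\<close> along the tree are transition
  probabilities, the words of length \<open>n\<close> having total weight 1, and \<open>H(\<xi> + K\<lambda>)\<close> is the weight of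
  the infinite path coding \<open>\<lambda>\<close>.  Parseval's identity says that almost every path is eventually
  zero, and this follows once every node can be continued to such a path with conditional weight
  bounded below.  A node state far from the integers is continued by a word of bounded level
  difference: long runs of zeros are harmless before a digit in \<open>q\<int>\<close>, and the other gaps are
  bounded.  A state close to an integer follows the path of that integer, which by maximality
  has positive weight, until it becomes eventually zero or leaves the vicinity of the integers.\<close>

section \<open>The Fourier transform of the Cantor measure\<close>

text \<open>The obstacle is that \<open>H\<close> vanishes at many integers, so compactness bounds
  it below only at a positive distance from \<int>. Along a run of zero digits the state shrinks
  towards the integer 0. A nonzero digit t repairs this: t lies between -1 and b - 2 and K is
  coprime with b, so b does not divide K t, and the next state is near a fraction with denominator b
  that is not an integer. The cost of that digit is the mask at y + K t, where y is the state after
  the zeros. If q divides t, this is m(y), merely the next factor of the product for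
  \<open>H\<close>. Otherwise it tends to 0 with y, so the run has to be short. The level difference
  controls these runs as well as the number of nonzero digits. Near an integer z the bound has the
  form H(x - z) c, which reproduces itself under each step that stays near an integer. A path suited
  to z is found by testing maximality at the frequency K C(\<delta>) - b^n z, where n is the length
  of \<delta>. Finite sums replace a measure on paths: a deficit in Parseval's identity could always
  be lowered by a fixed proportion.\<close>

definition mask_sq :: "nat \<Rightarrow> real \<Rightarrow> real" where
  "mask_sq q x = (cmod ((\<Sum>a<q. cis (2 * pi * x * real a / real q)) / of_nat q))\<^sup>2"

definition cantor_hat_sq :: "nat \<Rightarrow> nat \<Rightarrow> real \<Rightarrow> real" where
  "cantor_hat_sq q b x = (cmod (char (cantor_measure q b) (2 * pi * x)))\<^sup>2"

lemma mask_sq_nonneg: "mask_sq q x \<ge> 0"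
  by (simp add: mask_sq_def)

lemma mask_sq_periodic:
  assumes "q \<ge> 1" and "int q dvd k"
  shows "mask_sq q (x + of_int k) = mask_sq q x"
proof -
  obtain j where j: "k = int q * j" using assms(2) by blast
  have "cis (2 * pi * (x + of_int k) * real a / real q) = cis (2 * pi * x * real a / real q)" for a
  proof -
    have "2 * pi * (x + of_int k) * real a / real q
        = 2 * pi * x * real a / real q + 2 * pi * of_int (j * int a)"
      using assms(1) by (simp add: j field_simps)
    then show ?thesis by (simp only: cis_mult[symmetric] cis_multiple_2pi[OF Ints_of_int] mult_1_right)
  qed
  then show ?thesis by (simp add: mask_sq_def)
qed

lemma cis_2pi_eq_1_iff: "cis (2 * pi * x) = 1 \<longleftrightarrow> x \<in> \<int>"
proof
  assume "cis (2 * pi * x) = 1"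
  then have "cos (2 * pi * x) = 1" by (metis cis.sel(1) one_complex.sel(1))
  then obtain n :: int where "2 * pi * x = of_int n * 2 * pi" by (auto simp: cos_one_2pi_int)
  then have "x = of_int n" by simp
  then show "x \<in> \<int>" by simp
qed (auto elim!: Ints_cases simp: cis_multiple_2pi)

text \<open>This closed form of a geometric sum locates the zeros of the mask. The numerator
  vanishes exactly at the integers, while at multiples of \<open>q\<close>, which are excluded here,
  the ratio of the series is 1.\<close>

lemma mask_sum_eq:
  assumes "q \<ge> 1" and "x / real q \<notin> \<int>"
  shows "(\<Sum>a<q. cis (2 * pi * x * real a / real q)) = (cis (2 * pi * x) - 1) / (cis (2 * pi * (x / real q)) - 1)"
proof -
  let ?z = "cis (2 * pi * (x / real q))"
  have z: "?z \<noteq> 1" using assms(2) by (simp only: cis_2pi_eq_1_iff not_False_eq_True)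
  have "(\<Sum>a<q. cis (2 * pi * x * real a / real q)) = (\<Sum>a<q. ?z ^ a)"
    unfolding Complex.DeMoivre by (intro sum.cong refl arg_cong[where f = cis]) simp
  also have "\<dots> = (?z ^ q - 1) / (?z - 1)" using z by (rule geometric_sum)
  also have "?z ^ q = cis (2 * pi * x)" using assms(1) by (simp add: Complex.DeMoivre)
  finally show ?thesis .
qed

lemma mask_sq_nonzero_nonint:
  assumes "q \<ge> 1" and "x \<notin> \<int>"
  shows "mask_sq q x > 0"
proof -
  have n: "x / real q \<notin> \<int>"
  proof
    assume "x / real q \<in> \<int>"
    then have "x / real q * of_nat q \<in> \<int>" by (intro Ints_mult Ints_of_nat)
    then show False using assms by simp
  qed
  have "cis (2 * pi * x) \<noteq> 1" using assms by (simp only: cis_2pi_eq_1_iff not_False_eq_True)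
  moreover have "cis (2 * pi * (x / real q)) \<noteq> 1" using n by (simp only: cis_2pi_eq_1_iff not_False_eq_True)
  ultimately show ?thesis using assms unfolding mask_sq_def mask_sum_eq[OF assms(1) n] by simp
qed

lemma mask_sq_int:
  assumes "q \<ge> 1" and "\<not> int q dvd k"
  shows "mask_sq q (of_int k) = 0"
proof -
  have n: "of_int k / real q \<notin> \<int>"
  proof
    assume "of_int k / real q \<in> \<int>"
    then obtain j where "of_int k / real q = of_int j" by (auto elim: Ints_cases)
    then have "(of_int k :: real) = of_int (int q * j)" using assms(1) by (simp add: field_simps)
    then show False using assms(2) by (metis dvd_triv_left of_int_eq_iff)
  qed
  have "cis (2 * pi * of_int k) = 1" by (simp only: cis_2pi_eq_1_iff Ints_of_int)
  then show ?thesis unfolding mask_sq_def mask_sum_eq[OF assms(1) n] by simp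
qed

text \<open>This is Parseval's identity on the cyclic group of order \<open>q\<close>: as a function
  of j, the mask polynomial at x + j is a Fourier sum with unimodular coefficients
  \<open>z a\<close> over the orthogonal characters \<open>w a\<close>. It makes the mask a
  transition probability.\<close>

lemma sum_mask_sq:
  assumes "q \<ge> 1"
  shows "(\<Sum>j<q. mask_sq q (x + real j)) = 1"
proof -
  define z where "z a = cis (2 * pi * x * real a / real q)" for a :: nat
  define w where "w a = cis (2 * pi * real a / real q)" for a :: nat
  have zw: "cis (2 * pi * (x + real j) * real a / real q) = z a * w a ^ j" for a j
    unfolding z_def w_def Complex.DeMoivre cis_mult
    by (intro arg_cong[where f = cis]) (simp add: field_simps add_divide_distrib)
  have orth: "(\<Sum>j<q. w a ^ j * cnj (w a' ^ j)) = (if a = a' then of_nat q else 0)"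
    if "a < q" "a' < q" for a a'
  proof -
    let ?u = "(real a - real a') / real q"
    have e: "w a ^ j * cnj (w a' ^ j) = cis (2 * pi * ?u) ^ j" for j
      unfolding w_def Complex.DeMoivre cis_cnj cis_mult
      by (intro arg_cong[where f = cis]) (simp add: field_simps diff_divide_distrib)
    show ?thesis
    proof (cases "a = a'")
      case False
      have "?u \<notin> \<int>"
      proof
        assume "?u \<in> \<int>"
        then obtain k where k: "?u = of_int k" by (auto elim: Ints_cases)
        then have "real_of_int (int a - int a') = of_int (k * int q)"
          using assms by (simp add: field_simps)
        then have eq: "int a - int a' = k * int q" by (simp only: of_int_eq_iff)
        then have "int q dvd int a - int a'" by simp
        moreover have "\<bar>int a - int a'\<bar> < int q" "int a - int a' \<noteq> 0" using that False by auto
        ultimately show False using dvd_imp_le_int[of "int a - int a'" "int q"] by linarith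
      qed
      then have "cis (2 * pi * ?u) \<noteq> 1" by (simp only: cis_2pi_eq_1_iff not_False_eq_True)
      then have "(\<Sum>j<q. cis (2 * pi * ?u) ^ j) = (cis (2 * pi * ?u) ^ q - 1) / (cis (2 * pi * ?u) - 1)"
        by (rule geometric_sum)
      also have "cis (2 * pi * ?u) ^ q = cis (2 * pi * of_int (int a - int a'))"
        unfolding Complex.DeMoivre using assms by (intro arg_cong[where f = cis]) simp
      also have "\<dots> = 1" by (simp only: cis_2pi_eq_1_iff Ints_of_int)
      finally show ?thesis using False by (simp only: e) simp
    next
      case True
      have "(\<Sum>j<q. w a ^ j * cnj (w a' ^ j)) = (\<Sum>j<q. cis (2 * pi * ?u) ^ j)"
        by (simp only: e)
      then show ?thesis using True by simp
    qed
  qed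
  have "complex_of_real (\<Sum>j<q. mask_sq q (x + real j))
      = (\<Sum>j<q. (\<Sum>a<q. z a * w a ^ j) * cnj (\<Sum>a<q. z a * w a ^ j)) / (of_nat q)\<^sup>2"
    unfolding mask_sq_def zw of_real_sum complex_norm_square sum_divide_distrib
    by (intro sum.cong refl) (simp add: power2_eq_square sum_divide_distrib[symmetric])
  also have "(\<Sum>j<q. (\<Sum>a<q. z a * w a ^ j) * cnj (\<Sum>a<q. z a * w a ^ j))
      = (\<Sum>j<q. \<Sum>a<q. \<Sum>a'<q. z a * cnj (z a') * (w a ^ j * cnj (w a' ^ j)))"
    by (simp add: sum_product mult_ac)
  also have "\<dots> = (\<Sum>a<q. \<Sum>a'<q. \<Sum>j<q. z a * cnj (z a') * (w a ^ j * cnj (w a' ^ j)))"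
    by (rule trans[OF sum.swap]) (intro sum.cong refl sum.swap)
  also have "\<dots> = (\<Sum>a<q. \<Sum>a'<q. if a = a' then z a * cnj (z a') * of_nat q else 0)"
    by (intro sum.cong refl, subst sum_distrib_left[symmetric]) (simp add: orth del: complex_cnj_power)
  also have "\<dots> = (\<Sum>a<q. of_nat q)"
    by (intro sum.cong refl) (simp add: z_def cis_cnj cis_mult)
  also have "\<dots> = (of_nat q)\<^sup>2" by (simp add: power2_eq_square)
  finally have "complex_of_real (\<Sum>j<q. mask_sq q (x + real j)) = 1" using assms by simp
  then show ?thesis using of_real_eq_1_iff by blast
qed

text \<open>Multiplication by \<open>K\<close> permutes the residues modulo \<open>q\<close>;
  \<open>g\<close> is that permutation. The form with \<open>d\<close> is made for the digits of the
  children of a node, which are known only modulo \<open>q\<close>.\<close>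

lemma sum_mask_sq_residues:
  assumes q: "q \<ge> 1" and K: "coprime K (int q)" and d: "\<And>i. i < q \<Longrightarrow> int q dvd d i - int i"
  shows "(\<Sum>i<q. mask_sq q (x + of_int (K * d i))) = 1"
proof -
  define g where "g i = nat ((K * int i) mod int q)" for i :: nat
  have g_lt: "g i < q" for i using q by (simp add: g_def nat_less_iff)
  have g_dvd: "int q dvd K * int i - int (g i)" for i
    using q by (simp add: g_def mod_eq_dvd_iff[symmetric])
  have inj: "inj_on g {..<q}"
  proof (rule inj_onI)
    fix i j assume ij: "i \<in> {..<q}" "j \<in> {..<q}" "g i = g j"
    have "int q dvd (K * int i - int (g i)) - (K * int j - int (g j))"
      by (intro dvd_diff g_dvd)
    then have "int q dvd K * (int i - int j)" using ij by (simp add: algebra_simps)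
    then have "int q dvd int i - int j" using K by (simp add: coprime_dvd_mult_right_iff coprime_commute)
    moreover have "\<bar>int i - int j\<bar> < int q" using ij by auto
    ultimately show "i = j" using dvd_imp_le_int[of "int i - int j" "int q"] by linarith
  qed
  have "g ` {..<q} = {..<q}"
    by (rule card_subset_eq) (use g_lt inj in \<open>auto simp: card_image\<close>)
  then have bij: "bij_betw g {..<q} {..<q}" using inj by (simp add: bij_betw_def)
  have "(\<Sum>i<q. mask_sq q (x + of_int (K * d i))) = (\<Sum>i<q. mask_sq q (x + real (g i)))"
  proof (rule sum.cong)
    fix i assume "i \<in> {..<q}"
    then have "int q dvd K * (d i - int i) + (K * int i - int (g i))"
      by (intro dvd_add dvd_mult d g_dvd) simp
    then have "int q dvd K * d i - int (g i)" by (simp add: algebra_simps)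
    from mask_sq_periodic[OF q this, of "x + real (g i)"]
    show "mask_sq q (x + of_int (K * d i)) = mask_sq q (x + real (g i))" by simp
  qed simp
  also have "\<dots> = (\<Sum>j<q. mask_sq q (x + real j))"
    by (rule sum.reindex_bij_betw[OF bij])
  also have "\<dots> = 1" by (rule sum_mask_sq[OF q])
  finally show ?thesis .
qed

context
  fixes q b :: nat
  assumes q: "q \<ge> 1" and b: "b \<ge> 2"
begin

lemma real_distribution_cantor: "real_distribution (cantor_measure q b)"
  using is_cantor_measure_cantor_measure[OF q b]
  by (auto simp: is_cantor_measure_def real_distribution_def
        real_distribution_axioms_def dest: sets_eq_imp_space_eq)

lemma cantor_hat_sq_nonneg: "cantor_hat_sq q b x \<ge> 0"
  by (simp add: cantor_hat_sq_def)

lemma cantor_hat_sq_le_1: "cantor_hat_sq q b x \<le> 1"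
proof -
  interpret real_distribution "cantor_measure q b" by (rule real_distribution_cantor)
  show ?thesis unfolding cantor_hat_sq_def by (intro power_le_one norm_ge_zero cmod_char_le_1)
qed

lemma cantor_hat_sq_0: "cantor_hat_sq q b 0 = 1"
proof -
  interpret real_distribution "cantor_measure q b" by (rule real_distribution_cantor)
  show ?thesis by (simp add: cantor_hat_sq_def char_zero)
qed

lemma continuous_cantor_hat_sq: "continuous_on A (cantor_hat_sq q b)"
proof -
  interpret real_distribution "cantor_measure q b" by (rule real_distribution_cantor)
  have "isCont (cantor_hat_sq q b) x" for x
    unfolding cantor_hat_sq_def
    by (intro continuous_intros isCont_o2[OF _ isCont_char])
  then show ?thesis by (simp add: continuous_at_imp_continuous_on)
qed

lemma cantor_hat_sq_rec: "cantor_hat_sq q b x = mask_sq q x * cantor_hat_sq q b (x / real b)"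
proof -
  have s: "(\<Sum>i = 0..q - 1. iexp (2 * pi * x * (real i / real q)))
     = (\<Sum>a<q. cis (2 * pi * x * real a / real q))"
    using q by (intro sum.cong) (auto simp: cis_conv_exp)
  show ?thesis
    unfolding cantor_hat_sq_def mask_sq_def
    using is_cantor_measure_char[OF q is_cantor_measure_cantor_measure[OF q b], of "2 * pi * x"]
    unfolding s by (simp add: norm_mult norm_divide power_mult_distrib power_divide)
qed

lemma cantor_hat_sq_prod:
  "cantor_hat_sq q b x = (\<Prod>j<n. mask_sq q (x / real b ^ j)) * cantor_hat_sq q b (x / real b ^ n)"
proof (induction n)
  case (Suc n)
  then show ?case
    using cantor_hat_sq_rec[of "x / real b ^ n"] by (simp add: mult.commute mult.left_commute)
qed simp

lemma cantor_hat_sq_le_prod: "cantor_hat_sq q b x \<le> (\<Prod>j<n. mask_sq q (x / real b ^ j))"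
  by (subst cantor_hat_sq_prod[of _ n])
    (intro mult_left_le cantor_hat_sq_le_1 prod_nonneg ballI mask_sq_nonneg)

lemma cantor_hat_sq_le_mask_sq: "cantor_hat_sq q b x \<le> mask_sq q x"
  using cantor_hat_sq_le_prod[of x 1] by simp

lemma cantor_hat_sq_near_0:
  assumes "\<epsilon> > 0"
  obtains \<eta> where "\<eta> > 0" "\<And>u. \<bar>u\<bar> \<le> \<eta> \<Longrightarrow> cantor_hat_sq q b u > 1 - \<epsilon>"
proof -
  have "isCont (cantor_hat_sq q b) 0"
    using continuous_cantor_hat_sq[of UNIV] by (simp add: continuous_on_eq_continuous_at)
  then obtain \<eta> where "\<eta> > 0" "\<And>u. \<bar>u\<bar> < \<eta> \<Longrightarrow> \<bar>cantor_hat_sq q b u - 1\<bar> < \<epsilon>"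
    using assms unfolding continuous_at_eps_delta cantor_hat_sq_0 by (auto simp: dist_real_def)
  note \<eta> = this
  have "cantor_hat_sq q b u > 1 - \<epsilon>" if "\<bar>u\<bar> \<le> \<eta> / 2" for u
  proof -
    have "\<bar>u\<bar> < \<eta>" using that \<eta>(1) by linarith
    from \<eta>(2)[OF this] show ?thesis by linarith
  qed
  then show ?thesis using \<eta>(1) by (intro that[of "\<eta> / 2"]) simp_all
qed

lemma div_power_tendsto_0: "(\<lambda>n. x / real b ^ n) \<longlonglongrightarrow> 0"
proof -
  have "(\<lambda>n. x * inverse (real b) ^ n) \<longlonglongrightarrow> x * 0"
    using b by (intro tendsto_intros LIMSEQ_realpow_zero) (auto simp: inverse_eq_divide)
  then show ?thesis by (simp add: field_simps power_inverse)
qed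

text \<open>If some x / b^j were an integer, so would be x. Hence all mask factors are positive, and
  after finitely many of them the remaining factor is close to the value 1 at 0.\<close>

lemma cantor_hat_sq_pos:
  assumes "x \<notin> \<int>"
  shows "cantor_hat_sq q b x > 0"
proof -
  obtain \<eta> where \<eta>: "\<eta> > 0" "\<And>u. \<bar>u\<bar> \<le> \<eta> \<Longrightarrow> cantor_hat_sq q b u > 1 - 1"
    using cantor_hat_sq_near_0[of 1] by auto
  have "eventually (\<lambda>n. \<bar>x / real b ^ n\<bar> < \<eta>) sequentially"
    using tendstoD[OF div_power_tendsto_0 \<eta>(1)] by (simp add: dist_real_def)
  then obtain n where n: "\<bar>x / real b ^ n\<bar> < \<eta>" by (auto simp: eventually_sequentially)
  have "x / real b ^ j \<notin> \<int>" for j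
  proof
    assume "x / real b ^ j \<in> \<int>"
    then have "x / real b ^ j * of_nat (b ^ j) \<in> \<int>" by (intro Ints_mult Ints_of_nat)
    then show False using assms b by simp
  qed
  then have "(\<Prod>j<n. mask_sq q (x / real b ^ j)) > 0"
    using mask_sq_nonzero_nonint[OF q] by (intro prod_pos) auto
  moreover have "cantor_hat_sq q b (x / real b ^ n) > 0" using \<eta>(2) n by fastforce
  ultimately show ?thesis by (subst cantor_hat_sq_prod[of _ n]) simp
qed

text \<open>The bound is the minimum of a continuous function on the compact set \<open>S\<close>,
  attained at a point outside \<int> and therefore positive.\<close>

lemma cantor_hat_sq_lower:
  assumes "\<eta> > 0"
  obtains h where "h > 0" "\<And>x. \<bar>x\<bar> \<le> M \<Longrightarrow> (\<And>z::int. \<bar>x - of_int z\<bar> \<ge> \<eta>) \<Longrightarrow> cantor_hat_sq q b x \<ge> h"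
proof -
  define S where "S = {-M..M} \<inter> (\<Inter>z::int. {x. \<bar>x - of_int z\<bar> \<ge> \<eta>})"
  have "compact S" unfolding S_def
    by (intro compact_Int_closed compact_Icc closed_INT ballI closed_Collect_le continuous_intros)
  show ?thesis
  proof (cases "S = {}")
    case True
    have "x \<in> S" if "\<bar>x\<bar> \<le> M" "\<And>z::int. \<bar>x - of_int z\<bar> \<ge> \<eta>" for x
      using that by (auto simp: S_def abs_le_iff)
    then show ?thesis using True by (intro that[of 1]) auto
  next
    case False
    obtain x0 where x0: "x0 \<in> S" "\<And>x. x \<in> S \<Longrightarrow> cantor_hat_sq q b x0 \<le> cantor_hat_sq q b x"
      using continuous_attains_inf[OF \<open>compact S\<close> False continuous_cantor_hat_sq] by blast
    have "x0 \<notin> \<int>"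
    proof
      assume "x0 \<in> \<int>"
      then obtain z where "x0 = of_int z" by (auto elim: Ints_cases)
      moreover have "\<bar>x0 - of_int z\<bar> \<ge> \<eta>" for z :: int using x0(1) by (simp add: S_def)
      ultimately show False using assms by (metis abs_zero diff_self not_le)
    qed
    then show ?thesis
      by (intro that[OF cantor_hat_sq_pos[OF \<open>x0 \<notin> \<int>\<close>]] x0(2)) (auto simp: S_def abs_le_iff)
  qed
qed

end

section \<open>Exponentials in \<open>L\<^sup>2\<close>\<close>

text \<open>Square integrability is built in because the integral of a non-integrable function is 0
  by convention, which would make the approximation vacuous.\<close>

definition exp_approximable :: "real measure \<Rightarrow> real set \<Rightarrow> (real \<Rightarrow> complex) \<Rightarrow> bool" where
  "exp_approximable \<mu> \<Lambda> f \<longleftrightarrow> square_integrable \<mu> f \<and>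
     (\<forall>\<epsilon>>0. \<exists>F c. finite F \<and> F \<subseteq> \<Lambda> \<and>
          (\<integral>x. (cmod (f x - (\<Sum>l\<in>F. c l * expo l x)))\<^sup>2 \<partial>\<mu>) < \<epsilon>)"

lemma cmod_expo [simp]: "cmod (expo l x) = 1"
  unfolding expo_def by (simp add: norm_exp)

lemma continuous_expo: "continuous_on A (expo l)"
  unfolding expo_def by (intro continuous_intros)

lemma expo_add: "expo (l + l') x = expo l x * expo l' x"
  by (simp add: expo_def exp_add[symmetric] algebra_simps)

lemma measurable_expo [measurable]: "expo l \<in> borel_measurable borel"
  by (intro borel_measurable_continuous_onI continuous_expo)

lemma cmod_add_square_le: "(cmod (x + y))\<^sup>2 \<le> 2 * (cmod x)\<^sup>2 + 2 * (cmod y)\<^sup>2"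
proof -
  have "(cmod (x + y))\<^sup>2 \<le> (cmod x + cmod y)\<^sup>2" by (intro power_mono norm_triangle_ineq) simp
  also have "\<dots> \<le> 2 * (cmod x)\<^sup>2 + 2 * (cmod y)\<^sup>2"
    using sum_squares_bound[of "cmod x" "cmod y"] by (simp add: power2_sum)
  finally show ?thesis .
qed

section \<open>The algebra of trigonometric polynomials\<close>

inductive_set trig_polys :: "(real \<Rightarrow> complex) set" where
  expo: "expo l \<in> trig_polys"
| add: "f \<in> trig_polys \<Longrightarrow> g \<in> trig_polys \<Longrightarrow> (\<lambda>x. f x + g x) \<in> trig_polys"
| scale: "f \<in> trig_polys \<Longrightarrow> (\<lambda>x. a * f x) \<in> trig_polys"

lemma trig_polys_mult_expo: "f \<in> trig_polys \<Longrightarrow> (\<lambda>x. f x * expo l x) \<in> trig_polys"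
proof (induction rule: trig_polys.induct)
  case (expo l')
  then show ?case using trig_polys.expo[of "l' + l"] by (simp add: expo_add[abs_def])
next
  case (add f g)
  then show ?case using trig_polys.add by (simp add: distrib_right)
next
  case (scale f a)
  then show ?case using trig_polys.scale[of "\<lambda>x. f x * expo l x" a] by (simp add: mult.assoc)
qed

lemma trig_polys_mult: "g \<in> trig_polys \<Longrightarrow> f \<in> trig_polys \<Longrightarrow> (\<lambda>x. f x * g x) \<in> trig_polys"
proof (induction rule: trig_polys.induct)
  case (expo l)
  then show ?case by (rule trig_polys_mult_expo)
next
  case (add g h)
  then show ?case using trig_polys.add by (simp add: distrib_left)
next
  case (scale g a)
  then show ?case using trig_polys.scale[of "\<lambda>x. f x * g x" a] by (simp add: mult.left_commute)
qed

lemma trig_polys_continuous: "f \<in> trig_polys \<Longrightarrow> continuous_on A f"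
  by (induction rule: trig_polys.induct) (auto intro: continuous_expo continuous_intros)

lemma trig_polys_const: "(\<lambda>_. c) \<in> trig_polys"
  using trig_polys.scale[OF trig_polys.expo[of 0], of c] by (simp add: expo_def[abs_def])

lemma trig_polys_sin: "(\<lambda>x. of_real (sin (2 * pi * l * x))) \<in> trig_polys"
proof -
  have "(\<lambda>x. (1 / (2 * \<i>)) * (expo (- l) x + (- 1) * expo l x)) \<in> trig_polys"
    by (intro trig_polys.intros)
  also have "(\<lambda>x. (1 / (2 * \<i>)) * (expo (- l) x + (- 1) * expo l x))
      = (\<lambda>x. of_real (sin (2 * pi * l * x)))"
    by (rule ext) (simp add: expo_def sin_of_real[symmetric] sin_exp_eq mult_ac)
  finally show ?thesis .
qed

text \<open>Stone-Weierstrass is a statement about real functions, hence the real functions that are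
  trigonometric polynomials. Points are separated by one sine of frequency 1 / (4 R), whose argument
  stays in [- pi / 2, pi / 2] on the interval, where sine is injective.\<close>

lemma real_trig_polys_function_ring:
  assumes "R > 0"
  shows "function_ring_on {g. (\<lambda>x. complex_of_real (g x)) \<in> trig_polys} {- R..R}"
proof
  fix f assume f: "f \<in> {g. (\<lambda>x. complex_of_real (g x)) \<in> trig_polys}"
  then have "continuous_on {- R..R} (\<lambda>x. Re (complex_of_real (f x)))"
    by (intro continuous_intros trig_polys_continuous) simp
  then show "continuous_on {- R..R} f" by simp
next
  fix x y :: real assume xy: "x \<in> {- R..R}" "y \<in> {- R..R}" "x \<noteq> y"
  let ?l = "1 / (4 * R)"
  have pi: "2 * pi * ?l * z = pi / 2 * (z / R)" for z using assms by (simp add: field_simps)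
  have b: "- (pi / 2) \<le> 2 * pi * ?l * z \<and> 2 * pi * ?l * z \<le> pi / 2" if "z \<in> {- R..R}" for z
    unfolding pi using that assms mult_left_mono[of "- 1" "z / R" "pi / 2"] mult_left_mono[of "z / R" 1 "pi / 2"]
    by (simp add: field_simps)
  have "sin (2 * pi * ?l * x) \<noteq> sin (2 * pi * ?l * y)"
  proof
    assume "sin (2 * pi * ?l * x) = sin (2 * pi * ?l * y)"
    moreover note b[OF xy(1)] b[OF xy(2)]
    ultimately have "2 * pi * ?l * x = 2 * pi * ?l * y" using sin_inj_pi by blast
    then show False using xy(3) assms by (simp only: pi) simp
  qed
  moreover have "(\<lambda>x. sin (2 * pi * ?l * x)) \<in> {g. (\<lambda>x. complex_of_real (g x)) \<in> trig_polys}"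
    unfolding mem_Collect_eq by (rule trig_polys_sin)
  ultimately show "\<exists>f\<in>{g. (\<lambda>x. complex_of_real (g x)) \<in> trig_polys}. f x \<noteq> f y"
    by (rule bexI)
qed (simp_all add: trig_polys.add trig_polys_mult trig_polys_const)

section \<open>Square integrable functions and their approximation by exponentials\<close>

context real_distribution
begin

lemma square_integrableI_bounded:
  assumes "f \<in> borel_measurable borel" and "\<And>x. cmod (f x) \<le> B"
  shows "square_integrable M f"
  unfolding square_integrable_def
proof
  show "f \<in> borel_measurable M" using assms(1) by simp
  then show "integrable M (\<lambda>x. (cmod (f x))\<^sup>2)"
    by (intro integrable_const_bound[of _ "B\<^sup>2"])
      (auto simp: abs_square_le_1 intro!: AE_I2 power_mono assms(2))
qed

lemma square_integrable_dominated:
  assumes "square_integrable M w" and "f \<in> borel_measurable borel" and "\<And>x. cmod (f x) \<le> B * cmod (w x)"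
  shows "square_integrable M f"
proof -
  have "integrable M (\<lambda>x. (cmod (f x))\<^sup>2)"
  proof (rule Bochner_Integration.integrable_bound)
    show "integrable M (\<lambda>x. B\<^sup>2 * (cmod (w x))\<^sup>2)" using assms(1) by (simp add: square_integrable_def)
    show "AE x in M. norm ((cmod (f x))\<^sup>2) \<le> norm (B\<^sup>2 * (cmod (w x))\<^sup>2)"
      using assms(3) by (auto simp: power_mult_distrib[symmetric] intro!: AE_I2 power_mono)
  qed (use assms(2) in simp)
  then show ?thesis using assms(2) by (simp add: square_integrable_def)
qed

lemma square_integrable_add:
  assumes "square_integrable M f" and "square_integrable M g"
  shows "square_integrable M (\<lambda>x. f x + g x)"
proof -
  have m: "f \<in> borel_measurable borel" "g \<in> borel_measurable borel"
    using assms by (auto simp: square_integrable_def)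
  have "integrable M (\<lambda>x. (cmod (f x + g x))\<^sup>2)"
  proof (rule Bochner_Integration.integrable_bound)
    show "integrable M (\<lambda>x. 2 * (cmod (f x))\<^sup>2 + 2 * (cmod (g x))\<^sup>2)"
      using assms by (simp add: square_integrable_def)
  qed (use m in \<open>auto intro!: AE_I2 cmod_add_square_le\<close>)
  then show ?thesis using m by (simp add: square_integrable_def)
qed

lemma square_integrable_scale:
  assumes "square_integrable M f"
  shows "square_integrable M (\<lambda>x. a * f x)"
  using assms by (intro square_integrable_dominated[OF assms, of _ "cmod a"])
    (auto simp: square_integrable_def norm_mult)

lemma square_integrable_diff:
  assumes "square_integrable M f" and "square_integrable M g"
  shows "square_integrable M (\<lambda>x. f x - g x)"
  using square_integrable_add[OF assms(1) square_integrable_scale[OF assms(2), of "- 1"]] by simp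

lemma square_integrable_expo: "square_integrable M (expo l)"
  by (intro square_integrableI_bounded[of _ 1]) simp_all

lemma square_integrable_expo_sum: "square_integrable M (\<lambda>x. \<Sum>l\<in>F. c l * expo l x)"
proof (rule square_integrableI_bounded[where B = "\<Sum>l\<in>F. cmod (c l)"])
  show "cmod (\<Sum>l\<in>F. c l * expo l x) \<le> (\<Sum>l\<in>F. cmod (c l))" for x
    by (rule sum_norm_le) (simp add: norm_mult)
qed simp

lemma integral_cmod_add_square_le:
  assumes "square_integrable M f" and "square_integrable M g"
  shows "(\<integral>x. (cmod (f x + g x))\<^sup>2 \<partial>M) \<le> 2 * (\<integral>x. (cmod (f x))\<^sup>2 \<partial>M) + 2 * (\<integral>x. (cmod (g x))\<^sup>2 \<partial>M)"
proof -
  have "(\<integral>x. (cmod (f x + g x))\<^sup>2 \<partial>M) \<le> (\<integral>x. 2 * (cmod (f x))\<^sup>2 + 2 * (cmod (g x))\<^sup>2 \<partial>M)"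
    using assms square_integrable_add[OF assms]
    by (intro integral_mono cmod_add_square_le) (auto simp: square_integrable_def)
  also have "\<dots> = 2 * (\<integral>x. (cmod (f x))\<^sup>2 \<partial>M) + 2 * (\<integral>x. (cmod (g x))\<^sup>2 \<partial>M)"
    using assms by (simp add: square_integrable_def)
  finally show ?thesis .
qed

text \<open>The square of a sum costs a factor 2 for each error, so it suffices to approximate f by
  g, and g by exponentials, to within \<epsilon> / 4.\<close>

lemma exp_approximable_limit:
  assumes f: "square_integrable M f"
    and g: "\<And>\<epsilon>. \<epsilon> > 0 \<Longrightarrow> \<exists>g. exp_approximable M \<Lambda> g \<and> (\<integral>x. (cmod (f x - g x))\<^sup>2 \<partial>M) < \<epsilon>"
  shows "exp_approximable M \<Lambda> f"
  unfolding exp_approximable_def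
proof (intro conjI allI impI f)
  fix \<epsilon> :: real assume e: "\<epsilon> > 0"
  obtain g where g: "exp_approximable M \<Lambda> g" "(\<integral>x. (cmod (f x - g x))\<^sup>2 \<partial>M) < \<epsilon> / 4"
    using g[of "\<epsilon> / 4"] e by auto
  obtain F c where F: "finite F" "F \<subseteq> \<Lambda>"
    "(\<integral>x. (cmod (g x - (\<Sum>l\<in>F. c l * expo l x)))\<^sup>2 \<partial>M) < \<epsilon> / 4"
    using g(1) e unfolding exp_approximable_def by (meson divide_pos_pos zero_less_numeral)
  have sg: "square_integrable M g" using g(1) by (simp add: exp_approximable_def)
  have "(\<integral>x. (cmod (f x - (\<Sum>l\<in>F. c l * expo l x)))\<^sup>2 \<partial>M)
      \<le> 2 * (\<integral>x. (cmod (f x - g x))\<^sup>2 \<partial>M) + 2 * (\<integral>x. (cmod (g x - (\<Sum>l\<in>F. c l * expo l x)))\<^sup>2 \<partial>M)"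
    using integral_cmod_add_square_le[OF square_integrable_diff[OF f sg]
        square_integrable_diff[OF sg square_integrable_expo_sum]] by simp
  also have "\<dots> < \<epsilon>" using g(2) F(3) by simp
  finally show "\<exists>F c. finite F \<and> F \<subseteq> \<Lambda> \<and>
      (\<integral>x. (cmod (f x - (\<Sum>l\<in>F. c l * expo l x)))\<^sup>2 \<partial>M) < \<epsilon>" using F by blast
qed

lemma exp_approximable_add:
  assumes f: "exp_approximable M \<Lambda> f" and g: "exp_approximable M \<Lambda> g"
  shows "exp_approximable M \<Lambda> (\<lambda>x. f x + g x)"
  unfolding exp_approximable_def
proof (intro conjI allI impI)
  have sf: "square_integrable M f" and sg: "square_integrable M g"
    using f g by (auto simp: exp_approximable_def)
  show "square_integrable M (\<lambda>x. f x + g x)" by (intro square_integrable_add sf sg)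
  fix \<epsilon> :: real assume "\<epsilon> > 0"
  then have e: "\<epsilon> / 4 > 0" by simp
  obtain F c where F: "finite F" "F \<subseteq> \<Lambda>"
    "(\<integral>x. (cmod (f x - (\<Sum>l\<in>F. c l * expo l x)))\<^sup>2 \<partial>M) < \<epsilon> / 4"
    using f e unfolding exp_approximable_def by blast
  obtain G d where G: "finite G" "G \<subseteq> \<Lambda>"
    "(\<integral>x. (cmod (g x - (\<Sum>l\<in>G. d l * expo l x)))\<^sup>2 \<partial>M) < \<epsilon> / 4"
    using g e unfolding exp_approximable_def by blast
  define a where "a l = (if l \<in> F then c l else 0) + (if l \<in> G then d l else 0)" for l
  have s: "(\<Sum>l\<in>F \<union> G. a l * expo l x) = (\<Sum>l\<in>F. c l * expo l x) + (\<Sum>l\<in>G. d l * expo l x)" for x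
  proof -
    have "(\<Sum>l\<in>F \<union> G. a l * expo l x) = (\<Sum>l\<in>F \<union> G. if l \<in> F then c l * expo l x else 0)
        + (\<Sum>l\<in>F \<union> G. if l \<in> G then d l * expo l x else 0)"
      unfolding sum.distrib[symmetric] by (intro sum.cong) (auto simp: a_def distrib_right)
    also have "(\<Sum>l\<in>F \<union> G. if l \<in> F then c l * expo l x else 0) = (\<Sum>l\<in>F. c l * expo l x)"
      using F(1) G(1) by (intro sum.mono_neutral_cong_right) auto
    also have "(\<Sum>l\<in>F \<union> G. if l \<in> G then d l * expo l x else 0) = (\<Sum>l\<in>G. d l * expo l x)"
      using F(1) G(1) by (intro sum.mono_neutral_cong_right) auto
    finally show ?thesis .
  qed
  have "(\<integral>x. (cmod (f x + g x - (\<Sum>l\<in>F \<union> G. a l * expo l x)))\<^sup>2 \<partial>M)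
      \<le> 2 * (\<integral>x. (cmod (f x - (\<Sum>l\<in>F. c l * expo l x)))\<^sup>2 \<partial>M)
       + 2 * (\<integral>x. (cmod (g x - (\<Sum>l\<in>G. d l * expo l x)))\<^sup>2 \<partial>M)"
    using integral_cmod_add_square_le[OF square_integrable_diff[OF sf square_integrable_expo_sum]
        square_integrable_diff[OF sg square_integrable_expo_sum]]
    unfolding s by (simp add: algebra_simps)
  also have "\<dots> < \<epsilon>" using F(3) G(3) by simp
  finally show "\<exists>F c. finite F \<and> F \<subseteq> \<Lambda> \<and>
      (\<integral>x. (cmod (f x + g x - (\<Sum>l\<in>F. c l * expo l x)))\<^sup>2 \<partial>M) < \<epsilon>"
    using F G by (intro exI[of _ "F \<union> G"] exI[of _ a]) auto
qed

lemma exp_approximable_scale: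
  assumes f: "exp_approximable M \<Lambda> f"
  shows "exp_approximable M \<Lambda> (\<lambda>x. a * f x)"
  unfolding exp_approximable_def
proof (intro conjI allI impI)
  show "square_integrable M (\<lambda>x. a * f x)"
    using f by (intro square_integrable_scale) (simp add: exp_approximable_def)
  fix \<epsilon> :: real assume "\<epsilon> > 0"
  \<comment> \<open>The summand 1 avoids a division by zero when a = 0.\<close>
  then have e: "\<epsilon> / ((cmod a)\<^sup>2 + 1) > 0" by (simp add: add_nonneg_pos)
  obtain F c where F: "finite F" "F \<subseteq> \<Lambda>"
    "(\<integral>x. (cmod (f x - (\<Sum>l\<in>F. c l * expo l x)))\<^sup>2 \<partial>M) < \<epsilon> / ((cmod a)\<^sup>2 + 1)"
    using f e unfolding exp_approximable_def by blast
  let ?I = "\<integral>x. (cmod (f x - (\<Sum>l\<in>F. c l * expo l x)))\<^sup>2 \<partial>M"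
  have "a * f x - (\<Sum>l\<in>F. (a * c l) * expo l x) = a * (f x - (\<Sum>l\<in>F. c l * expo l x))" for x
    by (simp add: sum_distrib_left algebra_simps)
  then have "(\<integral>x. (cmod (a * f x - (\<Sum>l\<in>F. (a * c l) * expo l x)))\<^sup>2 \<partial>M) = (cmod a)\<^sup>2 * ?I"
    by (simp add: norm_mult power_mult_distrib)
  also have "\<dots> \<le> ((cmod a)\<^sup>2 + 1) * ?I"
    by (intro mult_right_mono integral_nonneg) simp_all
  also have "\<dots> < \<epsilon>"
    using F(3) by (subst (asm) pos_less_divide_eq) (simp_all add: mult.commute add_nonneg_pos)
  finally show "\<exists>F c. finite F \<and> F \<subseteq> \<Lambda> \<and>
      (\<integral>x. (cmod (a * f x - (\<Sum>l\<in>F. c l * expo l x)))\<^sup>2 \<partial>M) < \<epsilon>"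
    using F by (intro exI[of _ F] exI[of _ "\<lambda>l. a * c l"]) auto
qed

text \<open>Dominated convergence applied to the squared errors. The dominating \<open>w\<close> is
  1 when indicators are built, and the function itself when it is approximated by simple
  functions.\<close>

lemma exp_approximable_dominated:
  assumes "\<And>n. exp_approximable M \<Lambda> (g n)" and "\<And>x. (\<lambda>n. g n x) \<longlonglongrightarrow> f x"
    and f [measurable]: "f \<in> borel_measurable borel"
    and w: "square_integrable M w" and "\<And>n x. cmod (g n x) \<le> B * cmod (w x)"
  shows "exp_approximable M \<Lambda> f"
proof (rule exp_approximable_limit)
  have "g n \<in> borel_measurable M" for n
    using assms(1)[of n] unfolding exp_approximable_def square_integrable_def by blast
  then have g [measurable]: "g n \<in> borel_measurable borel" for n by simp
  have fw: "cmod (f x) \<le> B * cmod (w x)" for x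
    by (rule LIMSEQ_le_const2[OF tendsto_norm[OF assms(2)]]) (use assms(5) in blast)
  show "square_integrable M f" by (rule square_integrable_dominated[OF w f fw])
  fix \<epsilon> :: real assume e: "\<epsilon> > 0"
  have "(\<lambda>n. \<integral>x. (cmod (f x - g n x))\<^sup>2 \<partial>M) \<longlonglongrightarrow> (\<integral>x. 0 \<partial>M)"
  proof (rule integral_dominated_convergence[where w = "\<lambda>x. (2 * B)\<^sup>2 * (cmod (w x))\<^sup>2"])
    show "AE x in M. (\<lambda>n. (cmod (f x - g n x))\<^sup>2) \<longlonglongrightarrow> 0"
    proof (rule AE_I2)
      fix x
      have "(\<lambda>n. (cmod (f x - g n x))\<^sup>2) \<longlonglongrightarrow> (cmod (f x - f x))\<^sup>2"
        by (intro tendsto_intros assms(2))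
      then show "(\<lambda>n. (cmod (f x - g n x))\<^sup>2) \<longlonglongrightarrow> 0" by simp
    qed
    show "AE x in M. norm ((cmod (f x - g n x))\<^sup>2) \<le> (2 * B)\<^sup>2 * (cmod (w x))\<^sup>2" for n
    proof (rule AE_I2)
      fix x
      have "cmod (f x - g n x) \<le> 2 * B * cmod (w x)"
        using norm_triangle_ineq4[of "f x" "g n x"] fw[of x] assms(5)[of n x] by simp
      then show "norm ((cmod (f x - g n x))\<^sup>2) \<le> (2 * B)\<^sup>2 * (cmod (w x))\<^sup>2"
        by (simp only: power_mult_distrib[symmetric] real_norm_def abs_power2) (intro power_mono, auto)
    qed
    show "integrable M (\<lambda>x. (2 * B)\<^sup>2 * (cmod (w x))\<^sup>2)"
      using w by (simp add: square_integrable_def)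
  qed simp_all
  then have "eventually (\<lambda>n. (\<integral>x. (cmod (f x - g n x))\<^sup>2 \<partial>M) < \<epsilon>) sequentially"
    using e by (intro order_tendstoD(2)[of _ 0]) simp_all
  then obtain n where "(\<integral>x. (cmod (f x - g n x))\<^sup>2 \<partial>M) < \<epsilon>"
    by (auto simp: eventually_sequentially)
  then show "\<exists>g. exp_approximable M \<Lambda> g \<and> (\<integral>x. (cmod (f x - g x))\<^sup>2 \<partial>M) < \<epsilon>"
    using assms(1) by blast
qed

context
  fixes \<Lambda> :: "real set" and R :: real
  assumes expo: "\<And>l. exp_approximable M \<Lambda> (expo l)"
    and R: "R > 0" and supp: "AE x in M. \<bar>x\<bar> \<le> R"
begin

lemma exp_approximable_const: "exp_approximable M \<Lambda> (\<lambda>_. c)"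
  using exp_approximable_scale[OF expo[of 0], of c] by (simp add: expo_def[abs_def])

lemma exp_approximable_sum:
  "finite I \<Longrightarrow> (\<And>i. i \<in> I \<Longrightarrow> exp_approximable M \<Lambda> (f i)) \<Longrightarrow> exp_approximable M \<Lambda> (\<lambda>x. \<Sum>i\<in>I. f i x)"
  by (induction I rule: finite_induct) (auto intro: exp_approximable_const exp_approximable_add)

lemma exp_approximable_trig_polys: "f \<in> trig_polys \<Longrightarrow> exp_approximable M \<Lambda> f"
  by (induction rule: trig_polys.induct)
    (auto intro: expo exp_approximable_add exp_approximable_scale)

text \<open>The Stone-Weierstrass approximation is uniform on {- R..R}. Outside that interval the
  approximant is uncontrolled, but there the measure has no mass.\<close>

lemma exp_approximable_continuous:
  assumes f: "continuous_on UNIV f" and B: "\<And>x::real. \<bar>f x\<bar> \<le> B"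
  shows "exp_approximable M \<Lambda> (\<lambda>x. complex_of_real (f x))"
proof (rule exp_approximable_limit)
  have [measurable]: "f \<in> borel_measurable borel"
    using f by (rule borel_measurable_continuous_onI)
  show sf: "square_integrable M (\<lambda>x. complex_of_real (f x))"
    by (rule square_integrableI_bounded[where B = B]) (use B in simp_all)
  fix \<epsilon> :: real assume e: "\<epsilon> > 0"
  define \<delta> where "\<delta> = sqrt (\<epsilon> / 2)"
  have d: "\<delta> > 0" using e by (simp add: \<delta>_def)
  interpret function_ring_on "{g. (\<lambda>x. complex_of_real (g x)) \<in> trig_polys}" "{- R..R}"
    by (rule real_trig_polys_function_ring[OF R])
  obtain g where g: "(\<lambda>x. complex_of_real (g x)) \<in> trig_polys" "\<And>x. x \<in> {- R..R} \<Longrightarrow> \<bar>f x - g x\<bar> < \<delta>"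
    using Stone_Weierstrass_basic[OF continuous_on_subset[OF f] d] by auto
  have ag: "exp_approximable M \<Lambda> (\<lambda>x. complex_of_real (g x))"
    by (rule exp_approximable_trig_polys[OF g(1)])
  then have sg: "square_integrable M (\<lambda>x. complex_of_real (g x))" by (simp add: exp_approximable_def)
  have "(\<integral>x. (cmod (complex_of_real (f x) - complex_of_real (g x)))\<^sup>2 \<partial>M) \<le> (\<integral>x. \<delta>\<^sup>2 \<partial>M)"
  proof (rule integral_mono_AE)
    show "integrable M (\<lambda>x. (cmod (complex_of_real (f x) - complex_of_real (g x)))\<^sup>2)"
      using square_integrable_diff[OF sf sg] by (simp add: square_integrable_def)
    show "AE x in M. (cmod (complex_of_real (f x) - complex_of_real (g x)))\<^sup>2 \<le> \<delta>\<^sup>2"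
      using supp
    proof eventually_elim
      case (elim x)
      then have "\<bar>f x - g x\<bar> < \<delta>" by (intro g(2)) auto
      then show ?case
        unfolding of_real_diff[symmetric] norm_of_real by (intro power_mono) auto
    qed
  qed simp
  also have "\<dots> < \<epsilon>" using e using prob_space by (simp add: \<delta>_def)
  finally show "\<exists>g. exp_approximable M \<Lambda> g \<and> (\<integral>x. (cmod (complex_of_real (f x) - g x))\<^sup>2 \<partial>M) < \<epsilon>"
    using ag by blast
qed

lemma square_integrable_one: "square_integrable M (\<lambda>_. 1)"
  by (rule square_integrableI_bounded[where B = 1]) simp_all

lemma exp_approximable_indicator_atMost: "exp_approximable M \<Lambda> (indicator {..a})"
proof (rule exp_approximable_dominated[OF _ _ _ square_integrable_one, where B = 1])
  \<comment> \<open>For n \<ge> 1 this is 1 up to a and falls linearly to 0 at a + 1 / n.\<close>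
  let ?g = "\<lambda>n x. max 0 (min 1 (1 - real n * (x - a)))"
  show "exp_approximable M \<Lambda> (\<lambda>x. complex_of_real (?g n x))" for n
    by (rule exp_approximable_continuous[where B = 1]) (auto intro!: continuous_intros)
  show "(\<lambda>n. complex_of_real (?g n x)) \<longlonglongrightarrow> indicator {..a} x" for x
  proof (rule tendsto_eventually)
    show "eventually (\<lambda>n. complex_of_real (?g n x) = indicator {..a} x) sequentially"
    proof (cases "x \<le> a")
      case True
      then have "real n * (x - a) \<le> 0" for n by (simp add: mult_nonneg_nonpos)
      then show ?thesis using True by (auto intro!: always_eventually simp: min_def)
    next
      case False
      obtain N where N: "1 / (x - a) < real N" using reals_Archimedean2 by blast
      have "?g n x = 0" if "n \<ge> N" for n
      proof -
        have "1 / (x - a) < real n" using N that by linarith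
        then have "1 \<le> real n * (x - a)" using False by (simp add: field_simps)
        then show ?thesis by simp
      qed
      then show ?thesis using False by (auto simp: eventually_sequentially intro!: exI[of _ N])
    qed
  qed
qed simp_all

text \<open>Dynkin's argument: the half-lines are stable under intersection and generate the Borel
  sets, and approximability passes to complements and to countable disjoint unions.\<close>

lemma exp_approximable_indicator:
  assumes "A \<in> sets borel"
  shows "exp_approximable M \<Lambda> (indicator A)"
proof -
  have sets: "sets borel = sigma_sets UNIV (range (atMost :: real \<Rightarrow> _))"
    by (subst borel_eq_atMost) (simp add: image_def)
  have "Int_stable (range (atMost :: real \<Rightarrow> _))"
    by (auto simp: Int_stable_def min_def)
  moreover have "range (atMost :: real \<Rightarrow> _) \<subseteq> Pow UNIV" by simp
  moreover have "A \<in> sigma_sets UNIV (range atMost)" using assms by (simp add: sets)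
  ultimately show ?thesis
  proof (induction A rule: sigma_sets_induct_disjoint)
    case (basic A)
    then show ?case using exp_approximable_indicator_atMost by auto
  next
    case empty
    then show ?case using exp_approximable_const[of 0] by simp
  next
    case (compl A)
    have "exp_approximable M \<Lambda> (\<lambda>x. 1 + (- 1) * indicator A x)"
      using compl by (intro exp_approximable_add exp_approximable_scale exp_approximable_const) auto
    also have "(\<lambda>x. 1 + (- 1) * indicator A x) = (indicator (UNIV - A) :: real \<Rightarrow> complex)"
      by (auto simp: fun_eq_iff indicator_def)
    finally show ?case using compl by simp
  next
    case (union A)
    have mA: "A i \<in> sets borel" for i
      using union by (auto simp: sets)
    have "exp_approximable M \<Lambda> (indicator (\<Union>i. A i))"
    proof (rule exp_approximable_dominated[OF _ _ _ square_integrable_one, where B = 1])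
      show "exp_approximable M \<Lambda> (\<lambda>x. \<Sum>i<n. indicator (A i) x)" for n
        using union by (intro exp_approximable_sum) auto
      have s: "(\<Sum>i<n. indicator (A i) x) = (indicator (\<Union>i<n. A i) x :: complex)" for n x
        by (subst indicator_UN_disjoint) (use union in \<open>auto simp: disjoint_family_on_def\<close>)
      show "(\<lambda>n. \<Sum>i<n. indicator (A i) x) \<longlonglongrightarrow> (indicator (\<Union>i. A i) x :: complex)" for x
        unfolding s by (rule LIMSEQ_indicator_UN)
      show "cmod (\<Sum>i<n. indicator (A i) x) \<le> 1 * cmod 1" for n x
        unfolding s by (simp add: indicator_def)
    qed (use mA in simp)
    then show ?case .
  qed
qed

theorem exp_approximable_square_integrable:
  assumes f: "square_integrable M f"
  shows "exp_approximable M \<Lambda> f"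
proof -
  have m: "f \<in> borel_measurable M" using f by (simp add: square_integrable_def)
  obtain s where s: "\<And>i. simple_function M (s i)" "\<And>x. (\<lambda>i. s i x) \<longlonglongrightarrow> f x"
      "\<And>i x. cmod (s i x) \<le> 2 * cmod (f x)"
    using borel_measurable_implies_sequence_metric[OF m, of 0] by (auto simp: dist_norm)
  show ?thesis
  proof (rule exp_approximable_dominated[OF _ s(2) _ f s(3)])
    fix i
    have fin: "finite (range (s i))" using s(1)[of i] by (simp add: simple_function_def)
    have rep: "s i = (\<lambda>x. \<Sum>y\<in>range (s i). y * indicator (s i -` {y}) x)"
    proof
      fix x
      have "(\<Sum>y\<in>range (s i). y * indicator (s i -` {y}) x) = (\<Sum>y\<in>range (s i). if s i x = y then y else 0)"
        by (intro sum.cong) (auto simp: indicator_def)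
      also have "\<dots> = s i x" using fin by simp
      finally show "s i x = (\<Sum>y\<in>range (s i). y * indicator (s i -` {y}) x)" ..
    qed
    have "s i -` {y} \<in> sets borel" for y
      using simple_functionD(2)[OF s(1)[of i], of "{y}"] by simp
    then have "exp_approximable M \<Lambda> (\<lambda>x. \<Sum>y\<in>range (s i). y * indicator (s i -` {y}) x)"
      by (intro exp_approximable_sum fin exp_approximable_scale exp_approximable_indicator)
    then show "exp_approximable M \<Lambda> (s i)" by (subst rep)
  qed (use m in simp)
qed

end

section \<open>Projections of exponentials and the criterion for spectra\<close>

lemma integral_expo: "(\<integral>x. expo l x \<partial>M) = char M (- (2 * pi * l))"
  by (simp add: char_def expo_def mult_ac)

lemma expo_mult_cnj: "expo l x * cnj (expo l' x) = expo (l - l') x"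
  by (simp add: expo_def exp_cnj exp_add[symmetric] algebra_simps)

lemma L2_inner_expo: "L2_inner M (expo l) (expo l') = char M (2 * pi * (l' - l))"
  by (simp add: L2_inner_def expo_mult_cnj integral_expo algebra_simps)

lemma integrable_expo: "integrable M (expo l)"
  by (rule integrable_const_bound[of _ 1]) auto

lemma L2_inner_expo_commute: "L2_inner M (expo l) (expo l') = cnj (L2_inner M (expo l') (expo l))"
proof -
  have "L2_inner M (expo l) (expo l') = (\<integral>x. cnj (expo l' x * cnj (expo l x)) \<partial>M)"
    by (simp add: L2_inner_def mult.commute)
  also have "\<dots> = cnj (L2_inner M (expo l') (expo l))" unfolding L2_inner_def
    by (rule Bochner_Integration.integral_cnj)
  finally show ?thesis .
qed

text \<open>Pythagoras for the projection of \<open>expo t\<close> onto the span of an orthonormal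
  family. It serves twice: nonnegativity gives Bessel's inequality, and a sum close to 1 makes
  \<open>expo t\<close> approximable.\<close>

lemma integral_expo_projection:
  assumes "finite F" and orth: "\<And>l l'. l \<in> F \<Longrightarrow> l' \<in> F \<Longrightarrow> l \<noteq> l' \<Longrightarrow> L2_inner M (expo l) (expo l') = 0"
  defines "c \<equiv> \<lambda>t l. L2_inner M (expo t) (expo l)"
  shows "(\<integral>x. (cmod (expo t x - (\<Sum>l\<in>F. c t l * expo l x)))\<^sup>2 \<partial>M) = 1 - (\<Sum>l\<in>F. (cmod (c t l))\<^sup>2)"
proof -
  have c: "(\<integral>x. expo (l - l') x \<partial>M) = c l l'" for l l'
    by (simp add: c_def L2_inner_def expo_mult_cnj)
  have cc: "c l l' = cnj (c l' l)" for l l' unfolding c_def by (rule L2_inner_expo_commute)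
  have oc: "c l l' = 0" if "l \<in> F" "l' \<in> F" "l \<noteq> l'" for l l'
    unfolding c_def by (rule orth[OF that])
  have c1: "c l l = 1" for l by (simp add: c_def L2_inner_expo char_zero)
  have e: "complex_of_real ((cmod (expo t x - (\<Sum>l\<in>F. c t l * expo l x)))\<^sup>2)
      = expo (t - t) x - (\<Sum>l\<in>F. cnj (c t l) * expo (t - l) x) - (\<Sum>l\<in>F. c t l * expo (l - t) x)
        + (\<Sum>l\<in>F. \<Sum>l'\<in>F. c t l * cnj (c t l') * expo (l - l') x)" for x
    unfolding complex_norm_square expo_mult_cnj[symmetric]
    by (simp add: left_diff_distrib right_diff_distrib sum_product sum_distrib_left sum_distrib_right mult_ac)
      (rule sum.swap)
  have "complex_of_real (\<integral>x. (cmod (expo t x - (\<Sum>l\<in>F. c t l * expo l x)))\<^sup>2 \<partial>M)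
     = (\<integral>x. expo (t - t) x - (\<Sum>l\<in>F. cnj (c t l) * expo (t - l) x) - (\<Sum>l\<in>F. c t l * expo (l - t) x)
        + (\<Sum>l\<in>F. \<Sum>l'\<in>F. c t l * cnj (c t l') * expo (l - l') x) \<partial>M)"
    unfolding e[symmetric] by (rule integral_complex_of_real[symmetric])
  also have "\<dots> = c t t - (\<Sum>l\<in>F. cnj (c t l) * c t l) - (\<Sum>l\<in>F. c t l * c l t)
        + (\<Sum>l\<in>F. \<Sum>l'\<in>F. c t l * cnj (c t l') * c l l')"
    unfolding c[of t t, symmetric] by (simp add: integrable_expo c)
  also have "(\<Sum>l\<in>F. \<Sum>l'\<in>F. c t l * cnj (c t l') * c l l') = (\<Sum>l\<in>F. c t l * cnj (c t l))"
  proof (rule sum.cong)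
    fix l assume l: "l \<in> F"
    have "(\<Sum>l'\<in>F. c t l * cnj (c t l') * c l l') = (\<Sum>l'\<in>F. if l = l' then c t l * cnj (c t l) else 0)"
      by (intro sum.cong) (use l in \<open>auto simp: c1 oc\<close>)
    then show "(\<Sum>l'\<in>F. c t l * cnj (c t l') * c l l') = c t l * cnj (c t l)"
      using l assms(1) by simp
  qed simp
  also have "c t t - (\<Sum>l\<in>F. cnj (c t l) * c t l) - (\<Sum>l\<in>F. c t l * c l t) + \<dots>
      = 1 - (\<Sum>l\<in>F. c t l * cnj (c t l))"
    using cc[of _ t] by (simp add: c1 mult.commute)
  also have "\<dots> = complex_of_real (1 - (\<Sum>l\<in>F. (cmod (c t l))\<^sup>2))"
    by (simp only: complex_norm_square of_real_diff of_real_sum of_real_1)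
  finally show ?thesis by (simp only: of_real_eq_iff)
qed

text \<open>Parseval's identity for a single exponential places it in the closed span of \<Lambda>.
  As the measure has bounded support, the exponentials of all frequencies together span a dense
  subspace.\<close>

lemma is_spectrumI:
  assumes orth: "orthogonal_set M \<Lambda>" and "R > 0" and "AE x in M. \<bar>x\<bar> \<le> R"
    and parseval: "\<And>t \<epsilon>. \<epsilon> > 0 \<Longrightarrow>
      \<exists>F\<subseteq>\<Lambda>. finite F \<and> (\<Sum>l\<in>F. (cmod (char M (2 * pi * (l - t))))\<^sup>2) > 1 - \<epsilon>"
  shows "is_spectrum M \<Lambda>"
proof -
  have "exp_approximable M \<Lambda> (expo t)" for t
    unfolding exp_approximable_def
  proof (intro conjI allI impI square_integrable_expo)
    fix \<epsilon> :: real assume "\<epsilon> > 0"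
    from parseval[OF this, of t] obtain F where F: "F \<subseteq> \<Lambda>" "finite F"
      "(\<Sum>l\<in>F. (cmod (char M (2 * pi * (l - t))))\<^sup>2) > 1 - \<epsilon>" by blast
    have "L2_inner M (expo l) (expo l') = 0" if "l \<in> F" "l' \<in> F" "l \<noteq> l'" for l l'
      using orth F(1) that unfolding orthogonal_set_def by blast
    from integral_expo_projection[OF F(2) this, of t] F(3)
    have "(\<integral>x. (cmod (expo t x - (\<Sum>l\<in>F. L2_inner M (expo t) (expo l) * expo l x)))\<^sup>2 \<partial>M) < \<epsilon>"
      unfolding L2_inner_expo by linarith
    then show "\<exists>F c. finite F \<and> F \<subseteq> \<Lambda> \<and>
        (\<integral>x. (cmod (expo t x - (\<Sum>l\<in>F. c l * expo l x)))\<^sup>2 \<partial>M) < \<epsilon>"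
      using F by (intro exI[of _ F] exI[of _ "\<lambda>l. L2_inner M (expo t) (expo l)"]) simp
  qed
  from exp_approximable_square_integrable[OF this assms(2,3)] show ?thesis
    using orth by (simp add: is_spectrum_def exp_approximable_def)
qed

text \<open>If \<open>expo t\<close> were orthogonal to \<Lambda>, the error \<open>h\<close> of any
  approximation from \<Lambda> would still have inner product 1 with \<open>expo t\<close>, so its
  norm could not be less than 1.\<close>

lemma is_spectrum_imp_maximal_orthogonal_set:
  assumes "is_spectrum M \<Lambda>"
  shows "maximal_orthogonal_set M \<Lambda>"
  unfolding maximal_orthogonal_set_def
proof (intro conjI allI impI notI)
  show "orthogonal_set M \<Lambda>" using assms by (simp add: is_spectrum_def)
  fix t assume t: "t \<notin> \<Lambda>" and orth: "orthogonal_set M (insert t \<Lambda>)"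
  have "(1::real) > 0" by simp
  then obtain F c where F: "finite F" "F \<subseteq> \<Lambda>"
    "(\<integral>x. (cmod (expo t x - (\<Sum>l\<in>F. c l * expo l x)))\<^sup>2 \<partial>M) < 1"
    using assms square_integrable_expo[of t] unfolding is_spectrum_def by blast
  define h where "h x = expo t x - (\<Sum>l\<in>F. c l * expo l x)" for x
  have sh: "square_integrable M h"
    unfolding h_def by (intro square_integrable_diff square_integrable_expo square_integrable_expo_sum)
  have m [measurable]: "h \<in> borel_measurable borel" unfolding h_def by measurable
  \<comment> \<open>This takes the place of Cauchy-Schwarz: integrated, it bounds the inner product
    by the mean of 1 and the squared error, which is below 1. It also yields the integrability of
    \<open>h\<close>.\<close>
  have h1: "2 * cmod (h x) \<le> 1 + (cmod (h x))\<^sup>2" for x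
    using sum_squares_bound[of 1 "cmod (h x)"] by simp
  have "cmod (h x) \<le> norm (1 + (cmod (h x))\<^sup>2)" for x
    using h1[of x] norm_ge_zero[of "h x"] zero_le_power2[of "cmod (h x)"] unfolding real_norm_def by linarith
  note h2 = this
  have ih: "integrable M h"
  proof (rule Bochner_Integration.integrable_bound)
    show "integrable M (\<lambda>x. 1 + (cmod (h x))\<^sup>2)" using sh by (simp add: square_integrable_def)
  qed (use h2 in simp_all)
  have "(\<integral>x. h x * cnj (expo t x) \<partial>M) = (\<integral>x. expo (t - t) x - (\<Sum>l\<in>F. c l * expo (l - t) x) \<partial>M)"
    unfolding h_def left_diff_distrib sum_distrib_right mult.assoc expo_mult_cnj by (rule refl)
  also have "\<dots> = L2_inner M (expo t) (expo t) - (\<Sum>l\<in>F. c l * L2_inner M (expo l) (expo t))"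
    by (simp add: integrable_expo L2_inner_def expo_mult_cnj)
  also have "(\<Sum>l\<in>F. c l * L2_inner M (expo l) (expo t)) = 0"
    using F(2) t orth by (intro sum.neutral) (auto simp: orthogonal_set_def)
  also have "L2_inner M (expo t) (expo t) - 0 = 1" by (simp add: L2_inner_expo char_zero)
  finally have "1 = cmod (\<integral>x. h x * cnj (expo t x) \<partial>M)" by (simp only: norm_one)
  also have "\<dots> \<le> (\<integral>x. cmod (h x * cnj (expo t x)) \<partial>M)" by (rule integral_norm_bound)
  also have "\<dots> \<le> (\<integral>x. (1 + (cmod (h x))\<^sup>2) / 2 \<partial>M)"
  proof (rule integral_mono)
    show "integrable M (\<lambda>x. cmod (h x * cnj (expo t x)))" using ih by (simp add: norm_mult)
    show "integrable M (\<lambda>x. (1 + (cmod (h x))\<^sup>2) / 2)" using sh by (simp add: square_integrable_def)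
    show "cmod (h x * cnj (expo t x)) \<le> (1 + (cmod (h x))\<^sup>2) / 2" for x
      using h1[of x] by (simp add: norm_mult)
  qed
  also have "\<dots> = (1 + (\<integral>x. (cmod (h x))\<^sup>2 \<partial>M)) / 2"
    using sh prob_space by (simp add: square_integrable_def)
  finally show False using F(3) by (simp add: h_def)
qed

end

section \<open>The support of the Cantor measure\<close>

lemma AE_cantor_measure_bounded:
  assumes q: "q \<ge> 1" and b: "b \<ge> 4"
  shows "AE x in cantor_measure q b. \<bar>x\<bar> \<le> 2"
proof -
  let ?\<mu> = "cantor_measure q b"
  have cm: "is_cantor_measure q b ?\<mu>" using q b by (intro is_cantor_measure_cantor_measure) auto
  interpret real_distribution ?\<mu>
    using cm by (auto simp: is_cantor_measure_def real_distribution_def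
        real_distribution_axioms_def dest: sets_eq_imp_space_eq)
  \<comment> \<open>Every contraction maps the larger interval into the smaller one: division by b
    \<ge> 4 leaves at most R / 2, and the translation is at most 1 \<le> R / 2. Doubling R again and
    again then pulls the total mass into {- 2..2}.\<close>
  have step: "prob {- (2 * R)..2 * R} \<le> prob {- R..R}" if "R \<ge> 2" for R
  proof -
    have i: "prob {- (2 * R)..2 * R} \<le> prob (cantor_map q b i -` {- R..R})" if "i \<in> {0..q - 1}" for i
    proof (rule finite_measure_mono)
      show "{- (2 * R)..2 * R} \<subseteq> cantor_map q b i -` {- R..R}"
      proof
        fix x assume x: "x \<in> {- (2 * R)..2 * R}"
        have "\<bar>x / real b\<bar> = \<bar>x\<bar> / real b" by (simp add: abs_divide)
        also have "\<dots> \<le> (2 * R) / 4"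
          using x b \<open>R \<ge> 2\<close> by (intro frac_le) auto
        finally have "\<bar>x / real b\<bar> \<le> R / 2" by simp
        moreover have "0 \<le> real i / real q" "real i / real q \<le> 1" using that q by (auto simp: field_simps)
        ultimately have "\<bar>cantor_map q b i x\<bar> \<le> R"
          using \<open>R \<ge> 2\<close> unfolding cantor_map_def by linarith
        then show "x \<in> cantor_map q b i -` {- R..R}" by auto
      qed
      show "cantor_map q b i -` {- R..R} \<in> events"
        using measurable_sets[OF cantor_map_measurable[of q b i], of "{- R..R}"] by simp
    qed
    have "prob {- (2 * R)..2 * R} = (1 / real q) * (\<Sum>i = 0..q - 1. prob {- (2 * R)..2 * R})"
      using q by simp
    also have "\<dots> \<le> (1 / real q) * (\<Sum>i = 0..q - 1. prob (cantor_map q b i -` {- R..R}))"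
      by (intro mult_left_mono sum_mono i) simp_all
    also have "\<dots> = prob {- R..R}" using cm by (simp add: is_cantor_measure_def)
    finally show ?thesis .
  qed
  have le: "prob {- (2 * 2 ^ n)..2 * 2 ^ n} \<le> prob {- 2..2 :: real}" for n
  proof (induction n)
    case (Suc n)
    have "(2::real) \<le> 2 * 2 ^ n" by simp
    from order_trans[OF step[OF this] Suc] show ?case by (simp only: power_Suc mult.left_commute)
  qed simp
  have "(\<lambda>n. prob {- (2 * 2 ^ n)..2 * 2 ^ n :: real}) \<longlonglongrightarrow> prob (\<Union>n. {- (2 * 2 ^ n)..2 * 2 ^ n :: real})"
  proof (rule finite_Lim_measure_incseq)
    show "incseq (\<lambda>n. {- (2 * 2 ^ n)..2 * 2 ^ n :: real})"
    proof (rule incseq_SucI)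
      fix n
      have "(2 * 2 ^ n :: real) \<le> 2 * 2 ^ Suc n" by simp
      then show "{- (2 * 2 ^ n)..2 * 2 ^ n :: real} \<subseteq> {- (2 * 2 ^ Suc n)..2 * 2 ^ Suc n}"
        unfolding atLeastatMost_subset_iff by linarith
    qed
  qed auto
  also have "(\<Union>n. {- (2 * 2 ^ n)..2 * 2 ^ n :: real}) = UNIV"
  proof -
    have "\<exists>n. x \<in> {- (2 * 2 ^ n)..2 * 2 ^ n :: real}" for x
    proof -
      obtain n where "\<bar>x\<bar> < 2 ^ n" using real_arch_pow[of 2 "\<bar>x\<bar>"] by auto
      then show ?thesis by (intro exI[of _ n]) auto
    qed
    then show ?thesis by blast
  qed
  finally have "prob UNIV \<le> prob {- 2..2 :: real}"
    by (rule LIMSEQ_le_const2) (use le in blast)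
  then have "prob {- 2..2 :: real} = 1" using prob_space prob_le_1[of "{- 2..2}"]
    unfolding space_eq_univ by linarith
  then have "AE x in ?\<mu>. x \<in> {- 2..2}" by (rule AE_prob_1)
  then show ?thesis by eventually_elim auto
qed

section \<open>Digit expansions along the tree\<close>

text \<open>The expansion in base b whose digits are read along the path that leaves node \<delta>
  by the given word, least significant digit first. The recursion removes the lowest digit, just as
  the functional equation of \<open>H\<close> does.\<close>

primrec digit_value :: "(nat list \<Rightarrow> int) \<Rightarrow> nat \<Rightarrow> nat list \<Rightarrow> nat list \<Rightarrow> int" where
  "digit_value \<tau> b \<delta> [] = 0"
| "digit_value \<tau> b \<delta> (i # \<omega>) = \<tau> (\<delta> @ [i]) + int b * digit_value \<tau> b (\<delta> @ [i]) \<omega>"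

lemma digit_value_append:
  "digit_value \<tau> b \<delta> (\<omega> @ \<nu>) = digit_value \<tau> b \<delta> \<omega> + int b ^ length \<omega> * digit_value \<tau> b (\<delta> @ \<omega>) \<nu>"
  by (induction \<omega> arbitrary: \<delta>) (simp_all add: algebra_simps)

lemma digit_value_conv_sum:
  "digit_value \<tau> b \<delta> \<omega> = (\<Sum>k<length \<omega>. \<tau> (\<delta> @ take (Suc k) \<omega>) * int b ^ k)"
proof (induction \<omega> arbitrary: \<delta>)
  case (Cons i \<omega>)
  show ?case
    by (simp add: Cons sum.lessThan_Suc_shift sum_distrib_left mult_ac del: sum.lessThan_Suc)
qed simp

text \<open>The condition concerns proper extensions only; the digit at \<delta> itself may be
  nonzero.\<close>

definition terminal :: "(nat list \<Rightarrow> int) \<Rightarrow> nat list \<Rightarrow> bool" where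
  "terminal \<tau> \<delta> \<longleftrightarrow> (\<forall>k\<ge>1. \<tau> (\<delta> @ replicate k 0) = 0)"

lemma terminal_append_zeros: "terminal \<tau> \<delta> \<Longrightarrow> terminal \<tau> (\<delta> @ replicate k 0)"
  by (simp add: terminal_def replicate_add[symmetric])

lemma digit_value_zeros: "terminal \<tau> \<delta> \<Longrightarrow> digit_value \<tau> b \<delta> (replicate k 0) = 0"
proof (induction k arbitrary: \<delta>)
  case (Suc k)
  have "\<tau> (\<delta> @ [0]) = 0" using Suc.prems unfolding terminal_def by (metis One_nat_def le_refl replicate_0 replicate_Suc)
  moreover have "terminal \<tau> (\<delta> @ [0])" using terminal_append_zeros[OF Suc.prems, of 1] by simp
  ultimately show ?case using Suc.IH by simp
qed simp

lemma digit_value_append_zeros: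
  "terminal \<tau> (\<delta> @ \<omega>) \<Longrightarrow> digit_value \<tau> b \<delta> (\<omega> @ replicate k 0) = digit_value \<tau> b \<delta> \<omega>"
  by (simp add: digit_value_append digit_value_zeros)

lemma word_prefix_conv_map:
  "word_prefix \<delta> m = map (\<lambda>k. if k < length \<delta> then \<delta> ! k else 0) [0..<m]"
  by (rule nth_equalityI) (auto simp: word_prefix_def nth_append)

text \<open>The original condition asks for digits that vanish eventually. Appending enough zeros to
  the word moves it past the last nonzero digit and leaves all its prefixes in the sense of
  \<open>word_prefix\<close> unchanged, so finite sums over terminal words suffice.\<close>

lemma tree_Lambda_eq:
  assumes "q \<ge> 1"
  shows "tree_Lambda q b \<tau> = {of_int (digit_value \<tau> b [] \<delta>) | \<delta>. \<delta> \<in> words q \<and> terminal \<tau> \<delta>}"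
    (is "?L = ?R")
proof -
  have val: "(\<Sum>n. of_int (\<tau> (word_prefix \<delta> (Suc n))) * real b ^ n) = of_int (digit_value \<tau> b [] \<delta>)"
    if "terminal \<tau> \<delta>" for \<delta>
  proof -
    have "\<tau> (word_prefix \<delta> (Suc n)) = 0" if "n \<notin> {..<length \<delta>}" for n
      using \<open>terminal \<tau> \<delta>\<close> that
      by (simp add: word_prefix_def terminal_def del: replicate_Suc)
    then have "(\<Sum>n. of_int (\<tau> (word_prefix \<delta> (Suc n))) * real b ^ n)
        = (\<Sum>n<length \<delta>. of_int (\<tau> (word_prefix \<delta> (Suc n))) * real b ^ n)"
      by (intro suminf_finite) auto
    also have "\<dots> = (\<Sum>n<length \<delta>. of_int (\<tau> (take (Suc n) \<delta>) * int b ^ n))"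
      by (intro sum.cong) (auto simp: word_prefix_def)
    finally show ?thesis by (simp add: digit_value_conv_sum)
  qed
  show ?thesis
  proof (intro equalityI subsetI)
    fix x assume "x \<in> ?L"
    then obtain \<delta> where \<delta>: "\<delta> \<in> words q" "eventually (\<lambda>m. \<tau> (word_prefix \<delta> m) = 0) sequentially"
      "x = (\<Sum>n. of_int (\<tau> (word_prefix \<delta> (Suc n))) * real b ^ n)"
      unfolding tree_Lambda_def by blast
    obtain N where N: "\<And>m. m \<ge> N \<Longrightarrow> \<tau> (word_prefix \<delta> m) = 0"
      using \<delta>(2) unfolding eventually_sequentially by blast
    define \<epsilon> where "\<epsilon> = \<delta> @ replicate N 0"
    have pre: "word_prefix \<epsilon> m = word_prefix \<delta> m" for m
      unfolding word_prefix_conv_map \<epsilon>_def by (auto simp: nth_append)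
    have "\<tau> (\<epsilon> @ replicate k 0) = 0" for k
    proof -
      have "\<epsilon> @ replicate k 0 = word_prefix \<delta> (length \<epsilon> + k)"
        unfolding \<epsilon>_def word_prefix_conv_map by (rule nth_equalityI) (auto simp: nth_append)
      then show ?thesis using N[of "length \<epsilon> + k"] by (simp add: \<epsilon>_def)
    qed
    then have t: "terminal \<tau> \<epsilon>" by (simp add: terminal_def)
    have "\<epsilon> \<in> words q" using \<delta>(1) assms by (auto simp: words_def \<epsilon>_def)
    moreover have "x = of_int (digit_value \<tau> b [] \<epsilon>)"
      unfolding \<delta>(3) using val[OF t] by (simp add: pre)
    ultimately show "x \<in> ?R" using t by blast
  next
    fix x assume "x \<in> ?R"
    then obtain \<delta> where \<delta>: "\<delta> \<in> words q" "terminal \<tau> \<delta>" "x = of_int (digit_value \<tau> b [] \<delta>)" by blast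
    have "\<tau> (word_prefix \<delta> m) = 0" if "m \<ge> Suc (length \<delta>)" for m
      using \<delta>(2) that by (simp add: word_prefix_def terminal_def)
    then have "eventually (\<lambda>m. \<tau> (word_prefix \<delta> m) = 0) sequentially"
      unfolding eventually_sequentially by blast
    moreover have "x = (\<Sum>n. of_int (\<tau> (word_prefix \<delta> (Suc n))) * real b ^ n)"
      unfolding \<delta>(3) by (rule val[OF \<delta>(2), symmetric])
    ultimately show "x \<in> ?L" unfolding tree_Lambda_def using \<delta>(1) by blast
  qed
qed

section \<open>Distance to the integers\<close>

definition far_from_ints :: "real \<Rightarrow> real \<Rightarrow> bool" where
  "far_from_ints \<eta> x \<longleftrightarrow> (\<forall>z::int. \<eta> \<le> \<bar>x - of_int z\<bar>)"

lemma far_from_ints_mono: "far_from_ints \<eta> x \<Longrightarrow> \<eta>' \<le> \<eta> \<Longrightarrow> far_from_ints \<eta>' x"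
  unfolding far_from_ints_def by (meson order_trans)

lemma far_from_ints_add_int: "far_from_ints \<eta> x \<Longrightarrow> far_from_ints \<eta> (x + of_int k)"
  unfolding far_from_ints_def
proof
  fix z :: int
  assume "\<forall>z::int. \<eta> \<le> \<bar>x - of_int z\<bar>"
  then have "\<eta> \<le> \<bar>x - of_int (z - k)\<bar>" ..
  then show "\<eta> \<le> \<bar>x + of_int k - of_int z\<bar>" by (simp add: algebra_simps)
qed

text \<open>An integer z close to x / n makes the integer n z close to x, at n times the
  distance.\<close>

lemma far_from_ints_divide:
  assumes "far_from_ints \<eta> x" and "n > 0"
  shows "far_from_ints (\<eta> / real n) (x / real n)"
  unfolding far_from_ints_def
proof
  fix z :: int
  have "\<eta> \<le> \<bar>x - of_int (int n * z)\<bar>" using assms(1) unfolding far_from_ints_def by blast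
  moreover have "\<bar>x / real n - of_int z\<bar> = \<bar>x - of_int (int n * z)\<bar> / real n"
  proof -
    have "x / real n - of_int z = (x - of_int (int n * z)) / real n"
      using assms(2) by (simp add: field_simps)
    then show ?thesis by (simp add: abs_divide)
  qed
  ultimately show "\<eta> / real n \<le> \<bar>x / real n - of_int z\<bar>"
    using assms(2) by (simp add: divide_right_mono)
qed

text \<open>The integer k - n z is nonzero, so adding u leaves a modulus of at least 1 / 2. This is
  the mechanism by which states leave the vicinity of the integers.\<close>

lemma far_from_ints_near_fraction:
  assumes "n > 0" and "\<not> int n dvd k" and "\<bar>u\<bar> \<le> 1 / 2"
  shows "far_from_ints (1 / (2 * real n)) ((u + of_int k) / real n)"
  unfolding far_from_ints_def
proof
  fix z :: int
  have "k - int n * z \<noteq> 0" using assms(2) by (metis dvd_triv_left eq_iff_diff_eq_0)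
  then have "\<bar>k - int n * z\<bar> \<ge> 1" by linarith
  then have "\<bar>real_of_int (k - int n * z)\<bar> \<ge> 1" by linarith
  then have "\<bar>u + of_int (k - int n * z)\<bar> \<ge> 1 / 2" using assms(3) by linarith
  moreover have "(u + of_int k) / real n - of_int z = (u + of_int (k - int n * z)) / real n"
    using assms(1) by (simp add: field_simps)
  ultimately show "1 / (2 * real n) \<le> \<bar>(u + of_int k) / real n - of_int z\<bar>"
    using assms(1) by (simp add: abs_divide field_simps)
qed

section \<open>The level difference as a bound on gaps\<close>

definition nonzero_levels :: "(nat list \<Rightarrow> int) \<Rightarrow> nat list \<Rightarrow> (nat \<Rightarrow> nat) \<Rightarrow> nat set" where
  "nonzero_levels \<tau> \<delta> s = {m. m \<ge> 1 \<and> \<tau> (\<delta> @ map s [0..<m]) \<noteq> 0}"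

text \<open>A digit outside q \<int> may be preceded by at most \<open>D\<close> zero digits. The
  first alternative covers the run that starts at the node itself, like the convention n_0 = 0 in
  the level difference. With an infinite sequence of letters, moving to a later node is a mere shift
  of \<open>s\<close>.\<close>

definition gaps_bounded :: "nat \<Rightarrow> nat \<Rightarrow> (nat list \<Rightarrow> int) \<Rightarrow> nat list \<Rightarrow> (nat \<Rightarrow> nat) \<Rightarrow> bool" where
  "gaps_bounded D q \<tau> \<delta> s \<longleftrightarrow> (\<forall>n\<ge>1. \<not> int q dvd \<tau> (\<delta> @ map s [0..<n]) \<longrightarrow>
     n \<le> Suc D \<or> (\<exists>p\<in>nonzero_levels \<tau> \<delta> s. p < n \<and> n \<le> p + Suc D))"

text \<open>A gap before a digit outside q \<int> is one summand of the level difference, so it is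
  at most the whole. Because of the leading 0, entry k of \<open>0 # xs\<close> is the predecessor
  of \<open>xs ! k\<close>.\<close>

lemma level_diff_from_witness:
  assumes "level_diff_from q \<tau> \<delta> < enat D" and "q \<ge> 1"
  obtains s where "range s \<subseteq> {..<q}" "finite (nonzero_levels \<tau> \<delta> s)"
    "card (nonzero_levels \<tau> \<delta> s) \<le> D" "gaps_bounded D q \<tau> \<delta> s"
proof -
  obtain \<delta>' where \<delta>': "\<delta>' \<in> words q" "level_diff_at q \<tau> \<delta> \<delta>' < enat D"
    using assms unfolding level_diff_from_def INF_less_iff by blast
  define s where "s k = (if k < length \<delta>' then \<delta>' ! k else 0)" for k
  have pre: "word_prefix \<delta>' m = map s [0..<m]" for m
    unfolding word_prefix_conv_map s_def ..
  have A: "level_A \<tau> \<delta> \<delta>' = nonzero_levels \<tau> \<delta> s"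
    unfolding level_A_def nonzero_levels_def pre ..
  let ?A = "nonzero_levels \<tau> \<delta> s"
  define xs where "xs = sorted_list_of_set ?A"
  have fin: "finite ?A"
  proof (rule ccontr)
    assume "infinite ?A"
    then show False using \<delta>'(2) by (simp add: level_diff_at_def A)
  qed
  define S where "S = {j. 1 \<le> j \<and> j \<le> card ?A \<and> (0 # xs) ! j \<in> level_B q \<tau> \<delta> \<delta>'}"
  have bound: "card ?A + (\<Sum>j\<in>S. (0 # xs) ! j - (0 # xs) ! (j - 1) - 1) < D"
    using \<delta>'(2) fin unfolding level_diff_at_def Let_def A xs_def S_def by simp
  have finS: "finite S" unfolding S_def by (rule finite_subset[of _ "{..card ?A}"]) auto
  have xs: "set xs = ?A" "length xs = card ?A" "sorted_wrt (<) xs"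
    using fin by (auto simp: xs_def)
  have "n \<le> Suc D \<or> (\<exists>p\<in>?A. p < n \<and> n \<le> p + Suc D)"
    if n: "n \<ge> 1" "\<not> int q dvd \<tau> (\<delta> @ map s [0..<n])" for n
  proof -
    have nB: "n \<in> level_B q \<tau> \<delta> \<delta>'" using n by (simp add: level_B_def pre)
    have "\<tau> (\<delta> @ map s [0..<n]) \<noteq> 0" using n(2) by (metis dvd_0_right)
    then have "n \<in> set xs" using n(1) by (simp add: xs nonzero_levels_def)
    then obtain k where k: "k < length xs" "xs ! k = n" by (auto simp: in_set_conv_nth)
    have "Suc k \<in> S" using k nB xs(2) by (simp add: S_def)
    then have "n - (0 # xs) ! k - 1 \<le> (\<Sum>j\<in>S. (0 # xs) ! j - (0 # xs) ! (j - 1) - 1)"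
      using member_le_sum[of "Suc k" S "\<lambda>j. (0 # xs) ! j - (0 # xs) ! (j - 1) - 1"] finS k by simp
    then have le: "n \<le> (0 # xs) ! k + Suc D" using bound by linarith
    show ?thesis
    proof (cases k)
      case 0
      then show ?thesis using le by simp
    next
      case (Suc k')
      have "xs ! k' < n" using xs(3) k Suc by (auto intro: sorted_wrt_nth_less)
      moreover have "xs ! k' \<in> ?A" using xs(1) k Suc by (metis Suc_lessD nth_mem)
      ultimately show ?thesis using le Suc by auto
    qed
  qed
  then have "gaps_bounded D q \<tau> \<delta> s" unfolding gaps_bounded_def by blast
  moreover have "range s \<subseteq> {..<q}"
    using \<delta>'(1) assms(2) by (force simp: s_def words_def)
  ultimately show ?thesis using that fin bound by simp
qed

lemma nonzero_levels_shift:
  assumes "n \<ge> 1"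
  shows "nonzero_levels \<tau> (\<delta> @ map s [0..<n]) (\<lambda>k. s (k + n)) = {m. m \<ge> 1 \<and> m + n \<in> nonzero_levels \<tau> \<delta> s}"
    and "\<tau> ((\<delta> @ map s [0..<n]) @ map (\<lambda>k. s (k + n)) [0..<m]) = \<tau> (\<delta> @ map s [0..<m + n])"
proof -
  have e: "map s [0..<n] @ map (\<lambda>k. s (k + n)) [0..<m] = map s [0..<m + n]" for m
    by (rule nth_equalityI) (auto simp: nth_append)
  show "\<tau> ((\<delta> @ map s [0..<n]) @ map (\<lambda>k. s (k + n)) [0..<m]) = \<tau> (\<delta> @ map s [0..<m + n])"
    by (simp only: append_assoc e)
  show "nonzero_levels \<tau> (\<delta> @ map s [0..<n]) (\<lambda>k. s (k + n)) = {m. m \<ge> 1 \<and> m + n \<in> nonzero_levels \<tau> \<delta> s}"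
    unfolding nonzero_levels_def by (simp only: append_assoc e mem_Collect_eq) auto
qed

text \<open>Since n is the first nonzero level, no witness p is lost by the shift: p > n moves to p
  - n, and p = n becomes the new origin, which the first alternative covers.\<close>

lemma gaps_bounded_shift:
  assumes g: "gaps_bounded D q \<tau> \<delta> s" and n: "n \<in> nonzero_levels \<tau> \<delta> s"
    and min: "\<And>p. p \<in> nonzero_levels \<tau> \<delta> s \<Longrightarrow> n \<le> p"
  shows "gaps_bounded D q \<tau> (\<delta> @ map s [0..<n]) (\<lambda>k. s (k + n))"
  unfolding gaps_bounded_def
proof (intro allI impI)
  have n1: "n \<ge> 1" using n by (simp add: nonzero_levels_def)
  fix m :: nat
  assume m: "1 \<le> m" "\<not> int q dvd \<tau> ((\<delta> @ map s [0..<n]) @ map (\<lambda>k. s (k + n)) [0..<m])"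
  from m(2) have "\<not> int q dvd \<tau> (\<delta> @ map s [0..<m + n])"
    unfolding nonzero_levels_shift(2)[OF n1] .
  then consider "m + n \<le> Suc D" | p where "p \<in> nonzero_levels \<tau> \<delta> s" "p < m + n" "m + n \<le> p + Suc D"
    using g m(1) unfolding gaps_bounded_def by (metis trans_le_add1)
  then show "m \<le> Suc D \<or> (\<exists>p\<in>nonzero_levels \<tau> (\<delta> @ map s [0..<n]) (\<lambda>k. s (k + n)). p < m \<and> m \<le> p + Suc D)"
  proof cases
    case 2
    have "n \<le> p" by (rule min[OF 2(1)])
    show ?thesis
    proof (cases "p = n")
      case False
      then have "p - n \<in> nonzero_levels \<tau> (\<delta> @ map s [0..<n]) (\<lambda>k. s (k + n))"
        using 2(1) \<open>n \<le> p\<close> by (simp add: nonzero_levels_shift(1)[OF n1])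
      moreover have "p - n < m" "m \<le> p - n + Suc D" using 2 \<open>n \<le> p\<close> by auto
      ultimately show ?thesis by blast
    qed (use 2 in simp)
  qed simp
qed

section \<open>Transition weights\<close>

locale cantor_tree =
  fixes q b :: nat and \<tau> :: "nat list \<Rightarrow> int" and K :: int
  assumes q2: "q \<ge> 2" and q_dvd_b: "q dvd b" and b_div_q: "b div q \<ge> 2"
    and tree: "tree_mapping q b \<tau>" and coprime_K: "coprime K (int b)"
begin

lemma q1: "q \<ge> 1" and b4: "b \<ge> 4" and b2: "b \<ge> 2" and b_pos: "b > 0"
proof -
  have "b = q * (b div q)" using q_dvd_b by simp
  moreover have "q * (b div q) \<ge> 2 * 2" using q2 b_div_q by (intro mult_le_mono) auto
  ultimately show "b \<ge> 4" by linarith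
  then show "b \<ge> 2" "b > 0" by auto
qed (use q2 in simp)

abbreviation "m \<equiv> mask_sq q"
abbreviation "H \<equiv> cantor_hat_sq q b"
abbreviation "C \<equiv> digit_value \<tau> b"

lemmas H_nonneg = cantor_hat_sq_nonneg[OF q1 b2]
  and H_0 = cantor_hat_sq_0[OF q1 b2]
  and H_rec = cantor_hat_sq_rec[OF q1 b2]
  and H_prod = cantor_hat_sq_prod[OF q1 b2]
  and H_le_prod = cantor_hat_sq_le_prod[OF q1 b2]
  and H_le_m = cantor_hat_sq_le_mask_sq[OF q1 b2]

lemma q_dvd_b_int: "int q dvd int b"
  using q_dvd_b by simp

lemma coprime_K_q: "coprime K (int q)"
  using coprime_K q_dvd_b_int by (meson coprime_divisors dvd_refl)

lemma tau_residue:
  assumes "set \<delta> \<subseteq> {..<q}" and "i < q"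
  shows "int q dvd \<tau> (\<delta> @ [i]) - int i"
proof -
  have "\<delta> @ [i] \<in> words q" using assms by (auto simp: words_def)
  then obtain k where "\<tau> (\<delta> @ [i]) = int (last (\<delta> @ [i])) + int q * k"
    using tree unfolding tree_mapping_def by blast
  then show ?thesis by simp
qed

lemma tau_range:
  assumes "set \<delta> \<subseteq> {..<q}" and "i < q"
  shows "\<tau> (\<delta> @ [i]) \<in> {- 1..int b - 2}"
proof -
  have "\<delta> @ [i] \<in> words q" using assms by (auto simp: words_def)
  then show ?thesis using tree unfolding tree_mapping_def by blast
qed

text \<open>The congruence between digit and letter identifies runs of zero digits with runs of zero
  letters.\<close>

lemma tau_zero_letter:
  assumes "set \<delta> \<subseteq> {..<q}" and "i < q" and "\<tau> (\<delta> @ [i]) = 0"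
  shows "i = 0"
proof -
  have "int q dvd int i" using tau_residue[OF assms(1,2)] assms(3) by simp
  then show ?thesis using assms(2) by (auto dest: nat_dvd_not_less)
qed

lemma abs_K_tau_le:
  assumes "set \<delta> \<subseteq> {..<q}" and "i < q"
  shows "\<bar>real_of_int (K * \<tau> (\<delta> @ [i]))\<bar> \<le> \<bar>real_of_int K\<bar> * real b"
proof -
  have "\<bar>\<tau> (\<delta> @ [i])\<bar> \<le> int b" using tau_range[OF assms] b4 by auto
  then have "\<bar>real_of_int (\<tau> (\<delta> @ [i]))\<bar> \<le> real b" by linarith
  then show ?thesis by (simp add: abs_mult mult_left_mono)
qed

text \<open>Digits lie strictly between -b and b, so only the digit 0 is divisible by b; coprimality
  carries this over to the multiple by \<open>K\<close>.\<close>

lemma not_b_dvd_K_tau: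
  assumes "set \<delta> \<subseteq> {..<q}" and "i < q" and "\<tau> (\<delta> @ [i]) \<noteq> 0"
  shows "\<not> int b dvd K * \<tau> (\<delta> @ [i])"
proof
  assume "int b dvd K * \<tau> (\<delta> @ [i])"
  then have "int b dvd \<tau> (\<delta> @ [i])"
    using coprime_K by (simp add: coprime_dvd_mult_right_iff coprime_commute)
  then have "int b \<le> \<bar>\<tau> (\<delta> @ [i])\<bar>"
    using dvd_imp_le_int[OF assms(3), of "int b"] by simp
  then show False using tau_range[OF assms(1,2)] b4 by auto
qed

lemma m_add_b: "m (x + of_int (int b * k)) = m x"
  by (rule mask_sq_periodic[OF q1]) (use q_dvd_b_int in simp)

text \<open>The interval of radius \<open>M\<close> is invariant under transitions: the old state
  contributes at most M / b \<le> M / 2, and the digit at most \<bar>K\<bar> \<le> M / 2.\<close>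

lemma step_bound:
  assumes "\<bar>x\<bar> \<le> M" and "M \<ge> 2 * \<bar>real_of_int K\<bar>" and "set \<delta> \<subseteq> {..<q}" and "i < q"
  shows "\<bar>(x + of_int (K * \<tau> (\<delta> @ [i]))) / real b\<bar> \<le> M"
proof -
  have "\<bar>x + of_int (K * \<tau> (\<delta> @ [i]))\<bar> \<le> M + \<bar>real_of_int K\<bar> * real b"
    using abs_K_tau_le[OF assms(3,4)] assms(1) by linarith
  also have "\<bar>real_of_int K\<bar> * real b \<le> (M / 2) * real b"
    using assms(2) by (intro mult_right_mono) auto
  also have "M + (M / 2) * real b \<le> M * real b"
  proof -
    have "M * 2 \<le> M * real b" using assms(1) b2 by (intro mult_left_mono) auto
    then show ?thesis by simp
  qed
  finally show ?thesis using b_pos by (simp add: abs_divide field_simps)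
qed

text \<open>The higher digits shift the argument by a multiple of b, hence of q, which the mask does
  not see.\<close>

lemma H_digit:
  "H (x + of_int (K * (t + int b * z)))
    = m (x + of_int (K * t)) * H ((x + of_int (K * t)) / real b + of_int (K * z))"
proof -
  have "x + of_int (K * (t + int b * z)) = (x + of_int (K * t)) + of_int (int b * (K * z))"
    by (simp add: algebra_simps)
  moreover have "((x + of_int (K * t)) + of_int (int b * (K * z))) / real b
      = (x + of_int (K * t)) / real b + of_int (K * z)"
    using b_pos by (simp add: field_simps)
  ultimately show ?thesis
    using H_rec[of "(x + of_int (K * t)) + of_int (int b * (K * z))"] by (simp only: m_add_b)
qed

text \<open>The conditional probability of following a word from node \<delta>, given the state x
  there. The state is the current argument of \<open>H\<close>; each letter adds \<open>K\<close>
  times its digit and then divides by b.\<close>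

primrec weight :: "nat list \<Rightarrow> nat list \<Rightarrow> real \<Rightarrow> real" where
  "weight [] \<delta> x = 1"
| "weight (i # \<omega>) \<delta> x = m (x + of_int (K * \<tau> (\<delta> @ [i])))
     * weight \<omega> (\<delta> @ [i]) ((x + of_int (K * \<tau> (\<delta> @ [i]))) / real b)"

lemma weight_nonneg: "weight \<omega> \<delta> x \<ge> 0"
  by (induction \<omega> arbitrary: \<delta> x) (simp_all add: mask_sq_nonneg)

lemma state_Cons:
  "(x + of_int (K * C \<delta> (i # \<omega>))) / real b ^ length (i # \<omega>)
    = ((x + of_int (K * \<tau> (\<delta> @ [i]))) / real b + of_int (K * C (\<delta> @ [i]) \<omega>)) / real b ^ length \<omega>"
  using b_pos by (simp add: field_simps)

lemma H_split:
  "H (x + of_int (K * (C \<delta> \<omega> + int b ^ length \<omega> * z)))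
    = weight \<omega> \<delta> x * H ((x + of_int (K * C \<delta> \<omega>)) / real b ^ length \<omega> + of_int (K * z))"
proof (induction \<omega> arbitrary: \<delta> x)
  case (Cons i \<omega>)
  have "C \<delta> (i # \<omega>) + int b ^ length (i # \<omega>) * z
      = \<tau> (\<delta> @ [i]) + int b * (C (\<delta> @ [i]) \<omega> + int b ^ length \<omega> * z)"
    by (simp add: algebra_simps)
  then show ?case
    unfolding state_Cons by (simp only: H_digit Cons weight.simps mult.assoc)
qed simp

lemma state_bound:
  assumes "\<bar>x\<bar> \<le> M" and "M \<ge> 2 * \<bar>real_of_int K\<bar>" and "set \<delta> \<subseteq> {..<q}" and "set \<omega> \<subseteq> {..<q}"
  shows "\<bar>(x + of_int (K * C \<delta> \<omega>)) / real b ^ length \<omega>\<bar> \<le> M"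
  using assms
proof (induction \<omega> arbitrary: \<delta> x)
  case (Cons i \<omega>)
  then have "\<bar>(x + of_int (K * \<tau> (\<delta> @ [i]))) / real b\<bar> \<le> M" by (intro step_bound) auto
  then show ?case unfolding state_Cons using Cons.prems by (intro Cons.IH) auto
qed simp

definition nodes :: "nat \<Rightarrow> nat list set" where
  "nodes n = {\<omega>. set \<omega> \<subseteq> {..<q} \<and> length \<omega> = n}"

lemma finite_nodes: "finite (nodes n)"
  unfolding nodes_def by (rule finite_lists_length_eq) simp

text \<open>The digits of the children of a node run through all residues modulo q, so each node
  passes on exactly its own mass.\<close>

lemma sum_weight: "set \<delta> \<subseteq> {..<q} \<Longrightarrow> (\<Sum>\<omega>\<in>nodes n. weight \<omega> \<delta> x) = 1"
proof (induction n arbitrary: \<delta> x)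
  case 0
  have "nodes 0 = {[]}" by (auto simp: nodes_def)
  then show ?case by simp
next
  case (Suc n)
  have "nodes (Suc n) = (\<lambda>(i, \<omega>). i # \<omega>) ` ({..<q} \<times> nodes n)"
    by (auto simp: nodes_def length_Suc_conv)
  moreover have "inj_on (\<lambda>(i, \<omega>). i # \<omega>) ({..<q} \<times> nodes n)" by (auto simp: inj_on_def)
  ultimately have "(\<Sum>\<omega>\<in>nodes (Suc n). weight \<omega> \<delta> x)
      = (\<Sum>(i, \<omega>)\<in>{..<q} \<times> nodes n. weight (i # \<omega>) \<delta> x)"
    by (simp add: sum.reindex case_prod_unfold del: weight.simps)
  also have "\<dots> = (\<Sum>i<q. \<Sum>\<omega>\<in>nodes n. weight (i # \<omega>) \<delta> x)"
    by (rule sum.cartesian_product[symmetric])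
  also have "\<dots> = (\<Sum>i<q. m (x + of_int (K * \<tau> (\<delta> @ [i]))))"
  proof (intro sum.cong refl)
    fix i assume "i \<in> {..<q}"
    then have "set (\<delta> @ [i]) \<subseteq> {..<q}" using Suc.prems by auto
    from Suc.IH[OF this]
    show "(\<Sum>\<omega>\<in>nodes n. weight (i # \<omega>) \<delta> x) = m (x + of_int (K * \<tau> (\<delta> @ [i])))"
      by (simp add: sum_distrib_left[symmetric])
  qed
  also have "\<dots> = 1"
    by (rule sum_mask_sq_residues[OF q1 coprime_K_q]) (rule tau_residue[OF Suc.prems])
  finally show ?case .
qed

text \<open>At an integer a nonzero mask forces divisibility by q. Modulo q the argument is
  \<open>K\<close> times the difference of the first letters, so these agree; then one divides by b
  and repeats. With z = 0 this is uniqueness of expansions, and a general z admits frequencies that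
  do not come from the tree.\<close>

lemma prefix_if_nonvanishing:
  assumes "set p \<subseteq> {..<q}" and "set \<delta> \<subseteq> {..<q}" and "set \<epsilon> \<subseteq> {..<q}" and "length \<delta> \<le> length \<epsilon>"
    and "H (of_int (int b ^ length \<delta> * z + K * (C p \<epsilon> - C p \<delta>))) \<noteq> 0"
  shows "\<exists>\<omega>. \<epsilon> = \<delta> @ \<omega>"
  using assms
proof (induction \<delta> arbitrary: p \<epsilon>)
  case (Cons i \<delta>)
  then obtain j \<epsilon>' where e: "\<epsilon> = j # \<epsilon>'" by (cases \<epsilon>) auto
  have ij: "i < q" "j < q" using Cons.prems e by auto
  let ?v = "int b ^ length (i # \<delta>) * z + K * (C p \<epsilon> - C p (i # \<delta>))"
  have "H (of_int ?v) = m (of_int ?v) * H (of_int ?v / real b)" by (rule H_rec)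
  then have nz: "m (of_int ?v) \<noteq> 0" "H (of_int ?v / real b) \<noteq> 0" using Cons.prems(5) by auto
  have "int q dvd ?v" using nz(1) mask_sq_int[OF q1] by blast
  moreover have "?v = int b * (int b ^ length \<delta> * z + K * (C (p @ [j]) \<epsilon>' - C (p @ [i]) \<delta>))
      + K * ((\<tau> (p @ [j]) - int j) - (\<tau> (p @ [i]) - int i)) + K * (int j - int i)"
    by (simp add: e algebra_simps)
  moreover have "int q dvd int b * (int b ^ length \<delta> * z + K * (C (p @ [j]) \<epsilon>' - C (p @ [i]) \<delta>))
      + K * ((\<tau> (p @ [j]) - int j) - (\<tau> (p @ [i]) - int i))"
    using ij Cons.prems(1) by (intro dvd_add dvd_mult dvd_diff dvd_mult2 q_dvd_b_int tau_residue) auto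
  ultimately have "int q dvd K * (int j - int i)" by (metis dvd_add_right_iff)
  then have "int q dvd int j - int i"
    using coprime_K_q by (simp add: coprime_dvd_mult_right_iff coprime_commute)
  then have "i = j"
    using dvd_imp_le_int[of "int j - int i" "int q"] ij by linarith
  then have "of_int ?v / real b = of_int (int b ^ length \<delta> * z + K * (C (p @ [i]) \<epsilon>' - C (p @ [i]) \<delta>))"
    using b_pos by (simp add: e field_simps)
  then have "H (of_int (int b ^ length \<delta> * z + K * (C (p @ [i]) \<epsilon>' - C (p @ [i]) \<delta>))) \<noteq> 0"
    using nz(2) by simp
  then have "\<exists>\<omega>. \<epsilon>' = \<delta> @ \<omega>" using Cons.prems e ij by (intro Cons.IH[of "p @ [i]"]) auto
  then show ?case using e \<open>i = j\<close> by simp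
qed simp

lemma C_inj:
  assumes "\<delta> \<in> nodes n" and "\<epsilon> \<in> nodes n" and "C [] \<delta> = C [] \<epsilon>"
  shows "\<delta> = \<epsilon>"
proof -
  have "\<exists>\<omega>. \<epsilon> = \<delta> @ \<omega>"
    using assms prefix_if_nonvanishing[of "[]" \<delta> \<epsilon> 0] by (simp add: nodes_def H_0)
  then show ?thesis using assms by (auto simp: nodes_def)
qed

lemma terminal_eq_up_to_zeros:
  assumes "terminal \<tau> \<delta>" and "set \<delta> \<subseteq> {..<q}" and "terminal \<tau> \<epsilon>" and "set \<epsilon> \<subseteq> {..<q}"
    and "C [] \<delta> = C [] \<epsilon>"
  shows "\<delta> @ replicate (length \<epsilon>) 0 = \<epsilon> @ replicate (length \<delta>) 0"
proof (rule C_inj)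
  show "C [] (\<delta> @ replicate (length \<epsilon>) 0) = C [] (\<epsilon> @ replicate (length \<delta>) 0)"
    using assms by (simp add: digit_value_append_zeros)
qed (use assms q2 in \<open>auto simp: nodes_def\<close>)

text \<open>Beyond a terminal node the states tend to 0, where \<open>H\<close> is 1. The value of
  \<open>H\<close> here is thus the full product of masks along the path that ends in zeros, that
  is, its conditional weight seen from state x at node \<delta>.\<close>

definition reaches :: "real \<Rightarrow> nat list \<Rightarrow> real \<Rightarrow> bool" where
  "reaches c \<delta> x \<longleftrightarrow>
     (\<exists>\<omega>. set \<omega> \<subseteq> {..<q} \<and> terminal \<tau> (\<delta> @ \<omega>) \<and> c \<le> H (x + of_int (K * C \<delta> \<omega>)))"

lemma reaches_mono: "reaches c \<delta> x \<Longrightarrow> c' \<le> c \<Longrightarrow> reaches c' \<delta> x"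
  unfolding reaches_def by (meson order_trans)

lemma reaches_terminal: "terminal \<tau> \<delta> \<Longrightarrow> c \<le> H x \<Longrightarrow> reaches c \<delta> x"
  unfolding reaches_def by (intro exI[of _ "[]"]) simp

lemma reaches_step:
  assumes "i < q" and "reaches c (\<delta> @ [i]) ((x + of_int (K * \<tau> (\<delta> @ [i]))) / real b)"
  shows "reaches (m (x + of_int (K * \<tau> (\<delta> @ [i]))) * c) \<delta> x"
proof -
  obtain \<omega> where \<omega>: "set \<omega> \<subseteq> {..<q}" "terminal \<tau> ((\<delta> @ [i]) @ \<omega>)"
    "c \<le> H ((x + of_int (K * \<tau> (\<delta> @ [i]))) / real b + of_int (K * C (\<delta> @ [i]) \<omega>))"
    using assms(2) unfolding reaches_def by blast
  have "m (x + of_int (K * \<tau> (\<delta> @ [i]))) * c \<le> H (x + of_int (K * C \<delta> (i # \<omega>)))"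
    unfolding digit_value.simps H_digit by (intro mult_left_mono \<omega>(3) mask_sq_nonneg)
  then show ?thesis
    unfolding reaches_def using \<omega> assms(1) by (intro exI[of _ "i # \<omega>"]) auto
qed

lemma reaches_zeros:
  assumes "\<And>k. 1 \<le> k \<Longrightarrow> k \<le> l \<Longrightarrow> \<tau> (\<delta> @ replicate k 0) = 0"
    and "reaches c (\<delta> @ replicate l 0) (x / real b ^ l)"
  shows "reaches ((\<Prod>j<l. m (x / real b ^ j)) * c) \<delta> x"
  using assms
proof (induction l arbitrary: c)
  case (Suc l)
  have app: "(\<delta> @ replicate l 0) @ [0] = \<delta> @ replicate (Suc l) 0"
    by (simp add: replicate_append_same)
  have t0: "\<tau> ((\<delta> @ replicate l 0) @ [0]) = 0"
    unfolding app by (rule Suc.prems(1)) simp_all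
  have "reaches (m (x / real b ^ l + of_int (K * \<tau> ((\<delta> @ replicate l 0) @ [0]))) * c)
      (\<delta> @ replicate l 0) (x / real b ^ l)"
  proof (rule reaches_step)
    show "reaches c ((\<delta> @ replicate l 0) @ [0])
        ((x / real b ^ l + of_int (K * \<tau> ((\<delta> @ replicate l 0) @ [0]))) / real b)"
      unfolding t0 using Suc.prems(2) unfolding app by (simp add: mult.commute)
  qed (use q2 in simp)
  then have "reaches (m (x / real b ^ l) * c) (\<delta> @ replicate l 0) (x / real b ^ l)"
    by (simp only: t0) simp
  from Suc.IH[OF _ this] Suc.prems(1) show ?case by (simp add: mult_ac)
qed simp

lemma zeros_before_first_level:
  assumes \<delta>: "set \<delta> \<subseteq> {..<q}" and s: "range s \<subseteq> {..<q}"
    and n: "\<And>k. 1 \<le> k \<Longrightarrow> k \<le> n \<Longrightarrow> \<tau> (\<delta> @ map s [0..<k]) = 0"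
  shows "map s [0..<n] = replicate n 0"
proof -
  have "s j = 0" if "j < n" for j
  proof -
    have "set (\<delta> @ map s [0..<j]) \<subseteq> {..<q}" using \<delta> s by auto
    moreover have "s j < q" using s by auto
    moreover have "\<tau> ((\<delta> @ map s [0..<j]) @ [s j]) = 0" using n[of "Suc j"] that by simp
    ultimately show ?thesis by (rule tau_zero_letter)
  qed
  then show ?thesis by (intro nth_equalityI) auto
qed

text \<open>Each round of the induction follows a run of zeros and one nonzero digit. The distance
  \<eta> is left to vary because a round may decrease it; the constant depends on \<open>M\<close>,
  \<eta>, \<open>D\<close> and \<open>N\<close>, but on neither node nor state.\<close>

lemma reaches_if_far_card:
  assumes M: "M \<ge> 2 * \<bar>real_of_int K\<bar>" and "\<eta> > 0"
  shows "\<exists>c>0. \<forall>\<delta> x s. set \<delta> \<subseteq> {..<q} \<longrightarrow> range s \<subseteq> {..<q} \<longrightarrow> \<bar>x\<bar> \<le> M \<longrightarrow> far_from_ints \<eta> x \<longrightarrow>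
    finite (nonzero_levels \<tau> \<delta> s) \<longrightarrow> card (nonzero_levels \<tau> \<delta> s) = N \<longrightarrow>
    gaps_bounded D q \<tau> \<delta> s \<longrightarrow> reaches c \<delta> x"
  using \<open>\<eta> > 0\<close>
proof (induction N arbitrary: \<eta>)
  case 0
  obtain h where h: "h > 0" "\<And>x. \<bar>x\<bar> \<le> M \<Longrightarrow> (\<And>z::int. \<bar>x - of_int z\<bar> \<ge> \<eta>) \<Longrightarrow> H x \<ge> h"
    using cantor_hat_sq_lower[OF q1 b2 0] by blast
  have "reaches h \<delta> x"
    if "set \<delta> \<subseteq> {..<q}" "range s \<subseteq> {..<q}" "\<bar>x\<bar> \<le> M" "far_from_ints \<eta> x"
      "finite (nonzero_levels \<tau> \<delta> s)" "card (nonzero_levels \<tau> \<delta> s) = 0" for \<delta> x s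
  proof (rule reaches_terminal)
    have z: "\<tau> (\<delta> @ map s [0..<k]) = 0" if "1 \<le> k" for k
      using \<open>finite _\<close> \<open>card _ = 0\<close> that by (auto simp: nonzero_levels_def)
    have "map s [0..<k] = replicate k 0" for k
      by (rule zeros_before_first_level[OF that(1,2)]) (rule z)
    then show "terminal \<tau> \<delta>" using z by (simp add: terminal_def)
    show "h \<le> H x" using h(2)[OF that(3)] that(4) by (simp add: far_from_ints_def)
  qed
  then show ?case using h(1) by blast
next
  case (Suc N)
  have bl: "real b ^ l > 0" for l using b_pos by simp
  \<comment> \<open>From \<open>L\<close> zeros on, the state is smaller than 1 / 2, as
    \<open>far_from_ints_near_fraction\<close> requires.\<close>
  have "(\<lambda>n. M / real b ^ n) \<longlonglongrightarrow> 0" by (rule div_power_tendsto_0[OF q1 b2])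
  then have "eventually (\<lambda>n. M / real b ^ n < 1 / 2) sequentially" by (rule order_tendstoD) simp
  then obtain L where L: "\<And>n. n \<ge> L \<Longrightarrow> M / real b ^ n < 1 / 2" unfolding eventually_sequentially by blast
  define E where "E = Suc (max D L)"
  \<comment> \<open>The first value serves short runs, where the distance is divided by at most b^E
    (zeros and digit together); the second serves long runs, after which the new state is close to K
    t / b.\<close>
  define \<eta>' where "\<eta>' = min (\<eta> / real b ^ E) (1 / (2 * real b))"
  have "\<eta>' > 0" using Suc.prems b_pos by (simp add: \<eta>'_def)
  from Suc.IH[OF this] obtain c where c: "c > 0"
    "\<And>\<delta> x s. set \<delta> \<subseteq> {..<q} \<Longrightarrow> range s \<subseteq> {..<q} \<Longrightarrow> \<bar>x\<bar> \<le> M \<Longrightarrow> far_from_ints \<eta>' x \<Longrightarrow>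
    finite (nonzero_levels \<tau> \<delta> s) \<Longrightarrow> card (nonzero_levels \<tau> \<delta> s) = N \<Longrightarrow>
    gaps_bounded D q \<tau> \<delta> s \<Longrightarrow> reaches c \<delta> x" by blast
  obtain h1 where h1: "h1 > 0" "\<And>x. \<bar>x\<bar> \<le> M \<Longrightarrow> (\<And>z::int. \<bar>x - of_int z\<bar> \<ge> \<eta>) \<Longrightarrow> H x \<ge> h1"
    using cantor_hat_sq_lower[OF q1 b2 Suc.prems] by blast
  have "\<eta> / real b ^ D > 0" using Suc.prems b_pos by simp
  then obtain h2' where h2': "h2' > 0" "\<And>x. \<bar>x\<bar> \<le> M + \<bar>real_of_int K\<bar> * real b \<Longrightarrow>
      (\<And>z::int. \<bar>x - of_int z\<bar> \<ge> \<eta> / real b ^ D) \<Longrightarrow> H x \<ge> h2'"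
    using cantor_hat_sq_lower[OF q1 b2] by blast
  \<comment> \<open>The cap at 1 makes \<open>h1 * h2\<close> a valid bound also for digits in q
    \<int>, where \<open>h1\<close> alone is enough.\<close>
  define h2 where "h2 = min h2' 1"
  have h2: "h2 > 0" "h2 \<le> 1" using h2' by (auto simp: h2_def)
  have "reaches (h1 * h2 * c) \<delta> x"
    if \<delta>: "set \<delta> \<subseteq> {..<q}" and s: "range s \<subseteq> {..<q}" and x: "\<bar>x\<bar> \<le> M" and far: "far_from_ints \<eta> x"
      and fin: "finite (nonzero_levels \<tau> \<delta> s)" and card: "card (nonzero_levels \<tau> \<delta> s) = Suc N"
      and gaps: "gaps_bounded D q \<tau> \<delta> s" for \<delta> x s
  proof -
    let ?A = "nonzero_levels \<tau> \<delta> s"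
    define n where "n = Min ?A"
    have ne: "?A \<noteq> {}" using card by auto
    have n: "n \<in> ?A" unfolding n_def by (rule Min_in[OF fin ne])
    have min: "n \<le> p" if "p \<in> ?A" for p unfolding n_def by (rule Min_le[OF fin that])
    have n1: "n \<ge> 1" using n by (simp add: nonzero_levels_def)
    define l where "l = n - 1"
    have nl: "n = Suc l" using n1 by (simp add: l_def)
    have z: "\<tau> (\<delta> @ map s [0..<k]) = 0" if "1 \<le> k" "k \<le> l" for k
      using min[of k] that nl by (auto simp: nonzero_levels_def)
    have zeros: "map s [0..<k] = replicate k 0" if "k \<le> l" for k
      by (rule zeros_before_first_level[OF \<delta> s]) (use z that in auto)
    define \<delta>0 where "\<delta>0 = \<delta> @ replicate l 0"
    have \<delta>0: "set \<delta>0 \<subseteq> {..<q}" using \<delta> q2 by (auto simp: \<delta>0_def)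
    have sl: "s l < q" using s by auto
    have \<delta>n: "\<delta> @ map s [0..<n] = \<delta>0 @ [s l]" using zeros[of l] by (simp add: nl \<delta>0_def)
    define t where "t = \<tau> (\<delta>0 @ [s l])"
    have t0: "t \<noteq> 0" using n by (simp only: t_def \<delta>n[symmetric]) (simp add: nonzero_levels_def)
    define y where "y = x / real b ^ l"
    define x' where "x' = (y + of_int (K * t)) / real b"
    have gap: "l \<le> D" if "\<not> int q dvd t"
      using gaps n1 that min unfolding gaps_bounded_def t_def \<delta>n[symmetric] nl by fastforce
    have "real b ^ l \<ge> 1" using b_pos by (simp add: one_le_power)
    then have y: "\<bar>y\<bar> \<le> M"
      using x b_pos divide_left_mono[of 1 "real b ^ l" "\<bar>x\<bar>"] by (simp add: y_def abs_divide)
    have "\<bar>x'\<bar> \<le> M" unfolding x'_def t_def by (rule step_bound[OF y M \<delta>0 sl])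
    have far_y: "far_from_ints (\<eta> / real b ^ l) y"
      using far_from_ints_divide[OF far, of "b ^ l"] b_pos by (simp add: y_def)
    have "far_from_ints \<eta>' x'"
    proof (cases "l \<le> max D L")
      case True
      have "far_from_ints (\<eta> / real b ^ l / real b) x'"
        unfolding x'_def by (intro far_from_ints_divide far_from_ints_add_int far_y b_pos)
      moreover have "\<eta> / real b ^ E \<le> \<eta> / real b ^ l / real b"
      proof -
        have "real b ^ Suc l \<le> real b ^ E" using True b_pos by (intro power_increasing) (auto simp: E_def)
        then have "\<eta> / real b ^ E \<le> \<eta> / real b ^ Suc l"
          using Suc.prems b_pos by (intro divide_left_mono) auto
        then show ?thesis by (simp add: mult.commute)
      qed
      ultimately show ?thesis by (rule_tac far_from_ints_mono) (auto simp: \<eta>'_def)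
    next
      case False
      have "\<bar>y\<bar> \<le> M / real b ^ l" using x b_pos by (simp add: y_def abs_divide divide_right_mono)
      also have "\<dots> < 1 / 2" using L[of l] False by simp
      finally have "\<bar>y\<bar> \<le> 1 / 2" by simp
      moreover have "\<not> int b dvd K * t" using t0 unfolding t_def by (rule not_b_dvd_K_tau[OF \<delta>0 sl])
      ultimately have "far_from_ints (1 / (2 * real b)) x'"
        unfolding x'_def using b_pos by (intro far_from_ints_near_fraction)
      then show ?thesis by (rule far_from_ints_mono) (simp add: \<eta>'_def)
    qed
    let ?s = "\<lambda>k. s (k + n)"
    have A': "nonzero_levels \<tau> (\<delta>0 @ [s l]) ?s = (\<lambda>m. m - n) ` (?A - {n})"
    proof -
      have "nonzero_levels \<tau> (\<delta>0 @ [s l]) ?s = {m. m \<ge> 1 \<and> m + n \<in> ?A}"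
        unfolding \<delta>n[symmetric] by (rule nonzero_levels_shift(1)[OF n1])
      also have "\<dots> = (\<lambda>m. m - n) ` (?A - {n})"
      proof (intro equalityI subsetI)
        fix k assume "k \<in> {m. m \<ge> 1 \<and> m + n \<in> ?A}"
        then show "k \<in> (\<lambda>m. m - n) ` (?A - {n})" by (intro image_eqI[of _ _ "k + n"]) auto
      next
        fix k assume "k \<in> (\<lambda>m. m - n) ` (?A - {n})"
        then obtain p where "p \<in> ?A" "p \<noteq> n" "k = p - n" by auto
        then show "k \<in> {m. m \<ge> 1 \<and> m + n \<in> ?A}" using min[of p] by auto
      qed
      finally show ?thesis .
    qed
    have "inj_on (\<lambda>m. m - n) (?A - {n})" using min by (intro inj_on_diff_nat) auto
    then have "card (nonzero_levels \<tau> (\<delta>0 @ [s l]) ?s) = N"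
      unfolding A' using card n fin by (simp add: card_image)
    moreover have "finite (nonzero_levels \<tau> (\<delta>0 @ [s l]) ?s)" unfolding A' using fin by simp
    moreover have "gaps_bounded D q \<tau> (\<delta>0 @ [s l]) ?s"
      unfolding \<delta>n[symmetric] by (rule gaps_bounded_shift[OF gaps n min])
    moreover have "set (\<delta>0 @ [s l]) \<subseteq> {..<q}" "range ?s \<subseteq> {..<q}" using \<delta>0 sl s by auto
    ultimately have "reaches c (\<delta>0 @ [s l]) x'"
      using \<open>\<bar>x'\<bar> \<le> M\<close> \<open>far_from_ints \<eta>' x'\<close> by (intro c(2))
    then have "reaches (m (y + of_int (K * t)) * c) \<delta>0 y"
      unfolding t_def x'_def by (rule reaches_step[OF sl])
    then have R: "reaches ((\<Prod>j<l. m (x / real b ^ j)) * (m (y + of_int (K * t)) * c)) \<delta> x"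
      unfolding \<delta>0_def y_def by (rule reaches_zeros[rotated]) (use z zeros in simp)
    have Hx: "h1 \<le> H x" using h1(2)[OF x] far by (simp add: far_from_ints_def)
    have "h1 * h2 \<le> (\<Prod>j<l. m (x / real b ^ j)) * m (y + of_int (K * t))"
    proof (cases "int q dvd t")
      \<comment> \<open>Now y + K t and y have the same mask, so the product consists of the first l
        + 1 factors of \<open>H x\<close>, however long the run is.\<close>
      case True
      have "h1 * h2 \<le> h1" using h1(1) h2 by (simp add: mult_left_le)
      also have "\<dots> \<le> (\<Prod>j<Suc l. m (x / real b ^ j))" using Hx H_le_prod[of x "Suc l"] by linarith
      also have "\<dots> = (\<Prod>j<l. m (x / real b ^ j)) * m (y + of_int (K * t))"
        using mask_sq_periodic[OF q1, of "K * t" y] True by (simp add: y_def)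
      finally show ?thesis .
    next
      case False
      have "far_from_ints (\<eta> / real b ^ D) y"
      proof (rule far_from_ints_mono[OF far_y])
        have "real b ^ l \<le> real b ^ D" using gap[OF False] b_pos by (intro power_increasing) auto
        then show "\<eta> / real b ^ D \<le> \<eta> / real b ^ l" using Suc.prems b_pos by (intro divide_left_mono) auto
      qed
      then have "far_from_ints (\<eta> / real b ^ D) (y + of_int (K * t))" by (rule far_from_ints_add_int)
      moreover have "\<bar>y + of_int (K * t)\<bar> \<le> M + \<bar>real_of_int K\<bar> * real b"
        using abs_K_tau_le[OF \<delta>0 sl] y unfolding t_def by linarith
      ultimately have "h2' \<le> H (y + of_int (K * t))" using h2'(2) by (simp add: far_from_ints_def)
      then have "h2 \<le> m (y + of_int (K * t))"
        using H_le_m[of "y + of_int (K * t)"] by (simp add: h2_def)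
      moreover have "h1 \<le> (\<Prod>j<l. m (x / real b ^ j))" using Hx H_le_prod[of x l] by linarith
      ultimately show ?thesis using h1(1) h2(1) by (intro mult_mono) auto
    qed
    then have "h1 * h2 * c \<le> (\<Prod>j<l. m (x / real b ^ j)) * (m (y + of_int (K * t)) * c)"
      using c(1) by (simp add: mult.assoc[symmetric] mult_right_mono)
    with R show ?thesis by (rule reaches_mono)
  qed
  moreover have "h1 * h2 * c > 0" using h1 h2 c by simp
  ultimately show ?case by blast
qed

section \<open>Uniform lower bounds\<close>

text \<open>The level difference also bounds the number of nonzero levels, so finitely many
  constants of the previous lemma are involved and their minimum is positive.\<close>

lemma reaches_if_far:
  assumes M: "M \<ge> 2 * \<bar>real_of_int K\<bar>" and \<eta>: "\<eta> > 0" and D: "level_diff q \<tau> < \<infinity>"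
  shows "\<exists>c>0. \<forall>\<delta>\<in>words q. \<forall>x. \<bar>x\<bar> \<le> M \<longrightarrow> far_from_ints \<eta> x \<longrightarrow> reaches c \<delta> x"
proof -
  obtain D0 where D0: "level_diff q \<tau> = enat D0" using D by (cases "level_diff q \<tau>") auto
  define D where "D = Suc D0"
  define P where "P N c \<longleftrightarrow> c > 0 \<and> (\<forall>\<delta> x s. set \<delta> \<subseteq> {..<q} \<longrightarrow> range s \<subseteq> {..<q} \<longrightarrow> \<bar>x\<bar> \<le> M \<longrightarrow>
    far_from_ints \<eta> x \<longrightarrow> finite (nonzero_levels \<tau> \<delta> s) \<longrightarrow> card (nonzero_levels \<tau> \<delta> s) = N \<longrightarrow>
    gaps_bounded D q \<tau> \<delta> s \<longrightarrow> reaches c \<delta> x)" for N :: nat and c :: real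
  have "\<forall>N. \<exists>c. P N c" using reaches_if_far_card[OF M \<eta>] unfolding P_def by blast
  then obtain f where f: "\<And>N. P N (f N)" by metis
  define c where "c = Min (f ` {..D})"
  have "c > 0" using f by (simp add: c_def P_def)
  moreover have "reaches c \<delta> x" if \<delta>: "\<delta> \<in> words q" and x: "\<bar>x\<bar> \<le> M" "far_from_ints \<eta> x" for \<delta> x
  proof -
    have "level_diff_from q \<tau> \<delta> \<le> level_diff q \<tau>"
      unfolding level_diff_def by (rule SUP_upper[OF \<delta>])
    also have "\<dots> < enat D" by (simp add: D0 D_def)
    finally obtain s where s: "range s \<subseteq> {..<q}" "finite (nonzero_levels \<tau> \<delta> s)"
      "card (nonzero_levels \<tau> \<delta> s) \<le> D" "gaps_bounded D q \<tau> \<delta> s"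
      using level_diff_from_witness[OF _ q1] by blast
    have "set \<delta> \<subseteq> {..<q}" using \<delta> by (auto simp: words_def)
    then have "reaches (f (card (nonzero_levels \<tau> \<delta> s))) \<delta> x"
      using f[of "card (nonzero_levels \<tau> \<delta> s)"] s x unfolding P_def by blast
    moreover have "c \<le> f (card (nonzero_levels \<tau> \<delta> s))"
      unfolding c_def using s(3) by (intro Min_le) auto
    ultimately show ?thesis by (rule reaches_mono)
  qed
  ultimately show ?thesis by blast
qed

lemma words_append: "\<delta> \<in> words q \<Longrightarrow> i < q \<Longrightarrow> \<delta> @ [i] \<in> words q"
  by (auto simp: words_def)

lemma words_subset: "\<delta> \<in> words q \<Longrightarrow> set \<delta> \<subseteq> {..<q}"
  by (auto simp: words_def)

section \<open>States close to an integer\<close>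

context
  fixes M \<eta> c :: real
  assumes M: "M \<ge> 2 * \<bar>real_of_int K\<bar>"
    and \<eta>: "0 < \<eta>" "\<eta> \<le> 1 / (2 * real b)" "\<And>u. \<bar>u\<bar> \<le> \<eta> \<Longrightarrow> H u > 1 / 2"
    and c: "0 < c" "c \<le> 1"
    and far: "\<And>\<delta> x. \<delta> \<in> words q \<Longrightarrow> \<bar>x\<bar> \<le> M \<Longrightarrow> far_from_ints \<eta> x \<Longrightarrow> reaches c \<delta> x"
begin

text \<open>Put u = x - z. Nonvanishing of the mask at z + K t gives divisibility by q, so the mask
  at the true state is m(u). If b also divides z + K t, the next state is an integer plus u / b and
  H(u) = m(u) H(u / b) preserves the form of the bound. Otherwise the next state is far from \<int>,
  and H(u) \<le> m(u) suffices.\<close>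

lemma reaches_near_step:
  assumes \<delta>: "\<delta> \<in> words q" and i: "i < q" and x: "\<bar>x\<bar> \<le> M" and near: "\<bar>x - of_int z\<bar> \<le> \<eta>"
    and nz: "m (of_int (z + K * \<tau> (\<delta> @ [i]))) \<noteq> 0"
    and next_int: "\<And>z'. int b * z' = z + K * \<tau> (\<delta> @ [i]) \<Longrightarrow>
      reaches (H ((x - of_int z) / real b) * c) (\<delta> @ [i]) ((x + of_int (K * \<tau> (\<delta> @ [i]))) / real b)"
  shows "reaches (H (x - of_int z) * c) \<delta> x"
proof -
  let ?t = "\<tau> (\<delta> @ [i])" and ?u = "x - of_int z"
  have "int q dvd z + K * ?t" using nz mask_sq_int[OF q1] by blast
  from mask_sq_periodic[OF q1 this, of ?u] have mu: "m (x + of_int (K * ?t)) = m ?u"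
    by simp
  note step = reaches_step[OF i, of _ \<delta> x, unfolded mu]
  show ?thesis
  proof (cases "int b dvd z + K * ?t")
    case True
    then obtain z' where "z + K * ?t = int b * z'" by blast
    from step[OF next_int[OF this[symmetric]]] show ?thesis
      using H_rec[of ?u] by (simp add: mult.assoc)
  next
    case False
    have "1 / (2 * real b) \<le> 1 / 2" using b4 by (simp add: field_simps)
    then have "\<bar>?u\<bar> \<le> 1 / 2" using near \<eta>(2) by linarith
    with False have "far_from_ints (1 / (2 * real b)) ((?u + of_int (z + K * ?t)) / real b)"
      using b_pos by (intro far_from_ints_near_fraction)
    then have "far_from_ints \<eta> ((x + of_int (K * ?t)) / real b)"
      using far_from_ints_mono[OF _ \<eta>(2)] by simp
    then have "reaches c (\<delta> @ [i]) ((x + of_int (K * ?t)) / real b)"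
      by (intro far words_append[OF \<delta> i] step_bound[OF x M words_subset[OF \<delta>] i])
    from step[OF this] show ?thesis
      by (rule reaches_mono) (use H_le_m[of ?u] c in \<open>simp add: mult_right_mono\<close>)
  qed
qed

lemma near_next:
  assumes "\<bar>x - of_int z\<bar> \<le> \<eta>" and "int b * z' = z + k"
  shows "(x + of_int k) / real b - of_int z' = (x - of_int z) / real b"
    and "\<bar>(x + of_int k) / real b - of_int z'\<bar> \<le> \<eta>"
proof -
  have "real_of_int (int b * z') = of_int (z + k)" using assms(2) by simp
  then have "of_int k = real b * of_int z' - of_int z" by simp
  then show e: "(x + of_int k) / real b - of_int z' = (x - of_int z) / real b"
    using b_pos by (simp add: field_simps)
  have "\<eta> \<le> \<eta> * real b" using \<eta>(1) b_pos by simp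
  then show "\<bar>(x + of_int k) / real b - of_int z'\<bar> \<le> \<eta>"
    unfolding e using assms(1) b_pos by (simp add: abs_divide divide_le_eq)
qed

text \<open>Below a terminal node the digits are 0 and z turns into z / b as long as the state stays
  near an integer. So \<bar>z\<bar> decreases until z = 0, where H(x) itself is the weight, or until
  the state gets away from \<int>.\<close>

lemma reaches_near_terminal:
  assumes "\<delta> \<in> words q" and "terminal \<tau> \<delta>" and "\<bar>x\<bar> \<le> M" and "\<bar>x - of_int z\<bar> \<le> \<eta>" and "H (of_int z) \<noteq> 0"
  shows "reaches (H (x - of_int z) * c) \<delta> x"
  using assms
proof (induction "nat \<bar>z\<bar>" arbitrary: z \<delta> x rule: less_induct)
  case less
  show ?case
  proof (cases "z = 0")
    case True
    show ?thesis
      using less.prems(2) True c H_nonneg by (intro reaches_terminal) (auto intro: mult_left_le)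
  next
    case False
    have t0: "\<tau> (\<delta> @ [0]) = 0"
      using less.prems(2) unfolding terminal_def by (metis One_nat_def le_refl replicate_0 replicate_Suc)
    have q0: "0 < q" using q2 by simp
    show ?thesis
    proof (rule reaches_near_step[OF less.prems(1) q0 less.prems(3,4)])
      show "m (of_int (z + K * \<tau> (\<delta> @ [0]))) \<noteq> 0"
        using less.prems(5) H_rec[of "of_int z"] by (auto simp: t0)
      fix z' assume z': "int b * z' = z + K * \<tau> (\<delta> @ [0])"
      note n = near_next[OF less.prems(4) z']
      have "z = int b * z'" using z' t0 by simp
      then have "\<bar>z'\<bar> < \<bar>z\<bar>" using False b2 by (simp add: abs_mult)
      have "reaches (H ((x + of_int (K * \<tau> (\<delta> @ [0]))) / real b - of_int z') * c) (\<delta> @ [0])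
          ((x + of_int (K * \<tau> (\<delta> @ [0]))) / real b)"
      proof (rule less.hyps)
        show "nat \<bar>z'\<bar> < nat \<bar>z\<bar>" using \<open>\<bar>z'\<bar> < \<bar>z\<bar>\<close> by simp
        show "\<delta> @ [0] \<in> words q" by (rule words_append[OF less.prems(1) q0])
        show "terminal \<tau> (\<delta> @ [0])" using terminal_append_zeros[OF less.prems(2), of 1] by simp
        show "\<bar>(x + of_int (K * \<tau> (\<delta> @ [0]))) / real b\<bar> \<le> M"
          by (rule step_bound[OF less.prems(3) M words_subset[OF less.prems(1)] q0])
        show "\<bar>(x + of_int (K * \<tau> (\<delta> @ [0]))) / real b - of_int z'\<bar> \<le> \<eta>" by (rule n(2))
        show "H (of_int z') \<noteq> 0"
          using less.prems(5) H_rec[of "of_int z"] \<open>z = int b * z'\<close> b_pos by auto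
      qed
      then show "reaches (H ((x - of_int z) / real b) * c) (\<delta> @ [0])
          ((x + of_int (K * \<tau> (\<delta> @ [0]))) / real b)" by (simp only: n(1))
    qed
  qed
qed

text \<open>Nonvanishing at the integer z + K C(\<omega>) keeps every mask along \<omega> nonzero at
  the integer that shadows the state, and it is inherited by the next integer z' with the rest of
  \<omega>.\<close>

lemma reaches_near:
  assumes "\<delta> \<in> words q" and "set \<omega> \<subseteq> {..<q}" and "terminal \<tau> (\<delta> @ \<omega>)"
    and "\<bar>x\<bar> \<le> M" and "\<bar>x - of_int z\<bar> \<le> \<eta>" and "H (of_int (z + K * C \<delta> \<omega>)) \<noteq> 0"
  shows "reaches (H (x - of_int z) * c) \<delta> x"
  using assms
proof (induction \<omega> arbitrary: z \<delta> x)
  case Nil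
  then show ?case by (intro reaches_near_terminal) auto
next
  case (Cons i \<omega>)
  have i: "i < q" using Cons.prems(2) by simp
  let ?t = "\<tau> (\<delta> @ [i])"
  have Hz: "H (of_int (z + K * C \<delta> (i # \<omega>)))
      = m (of_int (z + K * ?t)) * H (of_int (z + K * ?t) / real b + of_int (K * C (\<delta> @ [i]) \<omega>))"
    using H_digit[of "of_int z" ?t "C (\<delta> @ [i]) \<omega>"] by simp
  show ?case
  proof (rule reaches_near_step[OF Cons.prems(1) i Cons.prems(4,5)])
    show "m (of_int (z + K * ?t)) \<noteq> 0" using Hz Cons.prems(6) by auto
    fix z' assume z': "int b * z' = z + K * ?t"
    note n = near_next[OF Cons.prems(5) z']
    have "reaches (H ((x + of_int (K * ?t)) / real b - of_int z') * c) (\<delta> @ [i])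
          ((x + of_int (K * ?t)) / real b)"
    proof (rule Cons.IH)
      show "\<delta> @ [i] \<in> words q" by (rule words_append[OF Cons.prems(1) i])
      show "\<bar>(x + of_int (K * ?t)) / real b\<bar> \<le> M"
        by (rule step_bound[OF Cons.prems(4) M words_subset[OF Cons.prems(1)] i])
      show "\<bar>(x + of_int (K * ?t)) / real b - of_int z'\<bar> \<le> \<eta>" by (rule n(2))
      have "of_int (z + K * ?t) / real b = of_int z'" using z'[symmetric] b_pos by simp
      then show "H (of_int (z' + K * C (\<delta> @ [i]) \<omega>)) \<noteq> 0"
        using Hz Cons.prems(6) by auto
    qed (use Cons.prems in auto)
    then show "reaches (H ((x - of_int z) / real b) * c) (\<delta> @ [i])
        ((x + of_int (K * ?t)) / real b)" by (simp only: n(1))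
  qed
qed

lemma reaches_if_nonvanishing:
  assumes "\<And>z::int. \<exists>\<omega>. set \<omega> \<subseteq> {..<q} \<and> terminal \<tau> (\<delta> @ \<omega>) \<and> H (of_int (z + K * C \<delta> \<omega>)) \<noteq> 0"
    and \<delta>: "\<delta> \<in> words q" and x: "\<bar>x\<bar> \<le> M"
  shows "reaches (c / 2) \<delta> x"
proof (cases "far_from_ints \<eta> x")
  case True
  then show ?thesis using far[OF \<delta> x] c by (auto intro: reaches_mono)
next
  case False
  then obtain z :: int where z: "\<bar>x - of_int z\<bar> < \<eta>" unfolding far_from_ints_def by (auto simp: not_le)
  obtain \<omega> where "set \<omega> \<subseteq> {..<q}" "terminal \<tau> (\<delta> @ \<omega>)" "H (of_int (z + K * C \<delta> \<omega>)) \<noteq> 0"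
    using assms(1) by blast
  then have "reaches (H (x - of_int z) * c) \<delta> x" using \<delta> x z by (intro reaches_near[of \<delta> \<omega>]) auto
  \<comment> \<open>\<eta> was chosen so that \<open>H\<close> exceeds 1 / 2 within \<eta> of
    0.\<close>
  moreover have "c / 2 \<le> H (x - of_int z) * c"
    using mult_right_mono[of "1 / 2" "H (x - of_int z)" c] \<eta>(3)[of "x - of_int z"] z c by simp
  ultimately show ?thesis by (rule reaches_mono)
qed

end

section \<open>Consequences of maximality\<close>

lemma L2_inner_cantor:
  "L2_inner (cantor_measure q b) (expo l) (expo l') = char (cantor_measure q b) (2 * pi * (l' - l))"
proof -
  interpret real_distribution "cantor_measure q b" by (rule real_distribution_cantor[OF q1 b2])
  show ?thesis by (rule L2_inner_expo)
qed

abbreviation "\<Lambda> \<equiv> (\<lambda>x. of_int K * x) ` tree_Lambda q b \<tau>"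

lemma Lambda_eq: "\<Lambda> = {of_int (K * C [] \<delta>) | \<delta>. \<delta> \<in> words q \<and> terminal \<tau> \<delta>}"
  unfolding tree_Lambda_eq[OF q1] by auto

text \<open>The test frequency \<open>l0\<close> differs from K C(\<delta>) by a multiple of b^n.
  Either it belongs to \<Lambda>, or by maximality it fails to be orthogonal to some element of
  \<Lambda>; in both cases \<open>H\<close> is nonzero at a difference \<open>l - l0\<close>. The
  path of \<open>l\<close> must then run through \<delta>, and dropping n mask factors leaves the
  integer z + K C(\<omega>).\<close>

lemma nonvanishing_if_maximal:
  assumes max: "maximal_orthogonal_set (cantor_measure q b) \<Lambda>" and \<delta>: "\<delta> \<in> words q"
  shows "\<exists>\<omega>. set \<omega> \<subseteq> {..<q} \<and> terminal \<tau> (\<delta> @ \<omega>) \<and> H (of_int (z + K * C \<delta> \<omega>)) \<noteq> 0"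
proof -
  define n where "n = length \<delta>"
  define l0 where "l0 = real_of_int (K * C [] \<delta> - int b ^ n * z)"
  have "\<exists>l\<in>\<Lambda>. H (l - l0) \<noteq> 0"
  proof (cases "l0 \<in> \<Lambda>")
    case True
    then show ?thesis by (intro bexI[of _ l0]) (simp_all add: H_0)
  next
    case False
    then have "\<not> orthogonal_set (cantor_measure q b) (insert l0 \<Lambda>)"
      and orth: "orthogonal_set (cantor_measure q b) \<Lambda>"
      using max by (auto simp: maximal_orthogonal_set_def)
    then obtain l l' where l: "l \<in> insert l0 \<Lambda>" "l' \<in> insert l0 \<Lambda>" "l \<noteq> l'"
      "L2_inner (cantor_measure q b) (expo l) (expo l') \<noteq> 0"
      unfolding orthogonal_set_def by auto
    have comm: "L2_inner (cantor_measure q b) (expo l') (expo l) \<noteq> 0"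
    proof -
      interpret real_distribution "cantor_measure q b" by (rule real_distribution_cantor[OF q1 b2])
      show ?thesis using l(4) L2_inner_expo_commute[of l l'] by auto
    qed
    have "l = l0 \<and> l' \<in> \<Lambda> \<or> l' = l0 \<and> l \<in> \<Lambda>"
      using l orth unfolding orthogonal_set_def by auto
    then show ?thesis
      using l(4) comm unfolding L2_inner_cantor cantor_hat_sq_def by auto
  qed
  then obtain \<epsilon> where \<epsilon>: "\<epsilon> \<in> words q" "terminal \<tau> \<epsilon>" "H (of_int (K * C [] \<epsilon>) - l0) \<noteq> 0"
    unfolding Lambda_eq by blast
  \<comment> \<open>Padding with n zeros makes the word at least as long as \<delta> while its value
    stays the same.\<close>
  define \<epsilon>' where "\<epsilon>' = \<epsilon> @ replicate n 0"
  have C\<epsilon>: "C [] \<epsilon>' = C [] \<epsilon>" unfolding \<epsilon>'_def using \<epsilon>(2) by (intro digit_value_append_zeros) simp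
  have set\<epsilon>: "set \<epsilon>' \<subseteq> {..<q}" using words_subset[OF \<epsilon>(1)] q2 by (auto simp: \<epsilon>'_def)
  have "real_of_int (int b ^ length \<delta> * z + K * (C [] \<epsilon>' - C [] \<delta>)) = of_int (K * C [] \<epsilon>) - l0"
    by (simp add: l0_def n_def C\<epsilon> algebra_simps)
  then have nz: "H (of_int (int b ^ length \<delta> * z + K * (C [] \<epsilon>' - C [] \<delta>))) \<noteq> 0"
    using \<epsilon>(3) by metis
  then obtain \<omega> where \<omega>: "\<epsilon>' = \<delta> @ \<omega>"
    using prefix_if_nonvanishing[OF _ words_subset[OF \<delta>] set\<epsilon>, of "[]" z] by (auto simp: \<epsilon>'_def n_def)
  have "int b ^ length \<delta> * z + K * (C [] \<epsilon>' - C [] \<delta>) = int b ^ n * (z + K * C \<delta> \<omega>)"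
    by (simp add: \<omega> digit_value_append n_def algebra_simps)
  then have "H (real_of_int (int b ^ n * (z + K * C \<delta> \<omega>))) \<noteq> 0" using nz by simp
  then have "H (of_int (z + K * C \<delta> \<omega>)) \<noteq> 0"
    using H_prod[of "real_of_int (int b ^ n * (z + K * C \<delta> \<omega>))" n] b_pos by auto
  moreover have "terminal \<tau> (\<delta> @ \<omega>)"
    unfolding \<omega>[symmetric] \<epsilon>'_def by (rule terminal_append_zeros[OF \<epsilon>(2)])
  ultimately show ?thesis using set\<epsilon> \<omega> by auto
qed

lemma reaches_uniformly:
  assumes max: "maximal_orthogonal_set (cantor_measure q b) \<Lambda>" and D: "level_diff q \<tau> < \<infinity>"
    and M: "M \<ge> 2 * \<bar>real_of_int K\<bar>"
  shows "\<exists>c>0. c \<le> 1 \<and> (\<forall>\<delta>\<in>words q. \<forall>x. \<bar>x\<bar> \<le> M \<longrightarrow> reaches c \<delta> x)"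
proof -
  obtain \<eta>0 where \<eta>0: "\<eta>0 > 0" "\<And>u. \<bar>u\<bar> \<le> \<eta>0 \<Longrightarrow> H u > 1 - 1 / 2"
    using cantor_hat_sq_near_0[OF q1 b2, of "1 / 2"] by auto
  define \<eta> where "\<eta> = min \<eta>0 (1 / (2 * real b))"
  have \<eta>: "0 < \<eta>" "\<eta> \<le> 1 / (2 * real b)" "\<And>u. \<bar>u\<bar> \<le> \<eta> \<Longrightarrow> H u > 1 / 2"
    using \<eta>0 b_pos by (auto simp: \<eta>_def)
  obtain c where c: "c > 0" "\<And>\<delta> x. \<delta> \<in> words q \<Longrightarrow> \<bar>x\<bar> \<le> M \<Longrightarrow> far_from_ints \<eta> x \<Longrightarrow> reaches c \<delta> x"
    using reaches_if_far[OF M \<eta>(1) D] by blast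
  have c1: "0 < min c 1" "min c 1 \<le> 1" using c(1) by auto
  have far: "reaches (min c 1) \<delta> x" if "\<delta> \<in> words q" "\<bar>x\<bar> \<le> M" "far_from_ints \<eta> x" for \<delta> x
    using c(2)[OF that] by (rule reaches_mono) simp
  have "reaches (min c 1 / 2) \<delta> x" if "\<delta> \<in> words q" "\<bar>x\<bar> \<le> M" for \<delta> x
    using reaches_if_nonvanishing[OF M \<eta> c1 far nonvanishing_if_maximal[OF max that(1)] that] .
  then show ?thesis using c1 by (intro exI[of _ "min c 1 / 2"]) auto
qed

section \<open>Parseval's identity\<close>

text \<open>Sums are indexed by values rather than words because words that differ by trailing zeros
  code the same frequency.\<close>

definition leaf_values :: "int set" where
  "leaf_values = {C [] \<delta> | \<delta>. \<delta> \<in> words q \<and> terminal \<tau> \<delta>}"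

lemma Lambda_conv_leaf_values: "\<Lambda> = (\<lambda>v. of_int (K * v)) ` leaf_values"
  unfolding Lambda_eq leaf_values_def by auto

lemma K_nonzero: "K \<noteq> 0"
  using coprime_K b4 by auto

lemma leaf_values_at_level:
  assumes "finite G" and "G \<subseteq> leaf_values"
  obtains N where "\<And>n v. n \<ge> N \<Longrightarrow> v \<in> G \<Longrightarrow> \<exists>\<delta>\<in>nodes n. terminal \<tau> \<delta> \<and> C [] \<delta> = v"
proof -
  have "\<forall>v\<in>G. \<exists>\<delta>. \<delta> \<in> words q \<and> terminal \<tau> \<delta> \<and> C [] \<delta> = v"
    using assms(2) unfolding leaf_values_def by blast
  then obtain f where f: "\<And>v. v \<in> G \<Longrightarrow> f v \<in> words q \<and> terminal \<tau> (f v) \<and> C [] (f v) = v" by metis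
  have "\<exists>\<delta>\<in>nodes n. terminal \<tau> \<delta> \<and> C [] \<delta> = v" if n: "n \<ge> Max ((length \<circ> f) ` G)" and v: "v \<in> G" for n v
  proof -
    have "length (f v) \<le> Max ((length \<circ> f) ` G)" using assms(1) v by (intro Max_ge) auto
    then have len: "length (f v) \<le> n" using n by linarith
    let ?\<delta> = "f v @ replicate (n - length (f v)) 0"
    have "?\<delta> \<in> nodes n" using words_subset[of "f v"] f[OF v] len q2 by (auto simp: nodes_def)
    moreover have "terminal \<tau> ?\<delta>" using f[OF v] by (intro terminal_append_zeros) simp
    moreover have "C [] ?\<delta> = v" using f[OF v] by (simp add: digit_value_append_zeros)
    ultimately show ?thesis by blast
  qed
  then show ?thesis by (rule that)
qed

text \<open>The mass of the nodes of a deep level that do not lead to \<open>G\<close> is about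
  \<open>1\<close> minus the sum over \<open>G\<close>, and every such node contributes a new value carrying at
  least the proportion \<open>c\<close> of its mass.\<close>

lemma sum_improvable:
  assumes c: "0 < c" and reach: "\<And>\<delta> x. \<delta> \<in> words q \<Longrightarrow> \<bar>x\<bar> \<le> M \<Longrightarrow> reaches c \<delta> x"
    and M: "M \<ge> 2 * \<bar>real_of_int K\<bar>" and \<xi>: "\<bar>\<xi>\<bar> \<le> M"
    and G: "finite G" "G \<subseteq> leaf_values" and \<epsilon>: "\<epsilon> > 0"
  defines "g \<equiv> \<lambda>v. H (\<xi> + of_int (K * v))"
  shows "\<exists>G'. finite G' \<and> G' \<subseteq> leaf_values \<and> sum g G + c * (1 - (1 + \<epsilon>) * sum g G) \<le> sum g G'"
proof -
  obtain N where N: "\<And>n v. n \<ge> N \<Longrightarrow> v \<in> G \<Longrightarrow> \<exists>\<delta>\<in>nodes n. terminal \<tau> \<delta> \<and> C [] \<delta> = v"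
    using leaf_values_at_level[OF G] by blast
  \<comment> \<open>This tolerance gives H(u) > 1 / (1 + \<epsilon>), so the weight of a terminal
    node exceeds the value of \<open>g\<close> there by at most the factor 1 + \<epsilon>.\<close>
  have "0 < 1 - 1 / (1 + \<epsilon>)" using \<epsilon> by simp
  then obtain \<eta> where \<eta>: "\<eta> > 0" "\<And>u. \<bar>u\<bar> \<le> \<eta> \<Longrightarrow> H u > 1 - (1 - 1 / (1 + \<epsilon>))"
    using cantor_hat_sq_near_0[OF q1 b2] by blast
  have "eventually (\<lambda>n. \<bar>(\<xi> + of_int (K * v)) / real b ^ n\<bar> < \<eta>) sequentially" for v
    using tendstoD[OF div_power_tendsto_0[OF q1 b2] \<eta>(1)] by (simp add: dist_real_def)
  then have "eventually (\<lambda>n. \<forall>v\<in>G. \<bar>(\<xi> + of_int (K * v)) / real b ^ n\<bar> < \<eta>) sequentially"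
    using G(1) by (simp add: eventually_ball_finite)
  then have "eventually (\<lambda>n. n \<ge> max N 1 \<and> (\<forall>v\<in>G. \<bar>(\<xi> + of_int (K * v)) / real b ^ n\<bar> < \<eta>)) sequentially"
    by (intro eventually_conj eventually_ge_at_top)
  then obtain n where n: "n \<ge> N" "n \<ge> 1" "\<And>v. v \<in> G \<Longrightarrow> \<bar>(\<xi> + of_int (K * v)) / real b ^ n\<bar> < \<eta>"
    unfolding eventually_sequentially by fastforce
  define w where "w \<delta> = weight \<delta> [] \<xi>" for \<delta>
  define T where "T = {\<delta> \<in> nodes n. terminal \<tau> \<delta> \<and> C [] \<delta> \<in> G}"
  define R where "R = nodes n - T"
  have fin: "finite T" "finite R" using finite_nodes[of n] by (auto simp: T_def R_def)
  have nodes_words: "\<delta> \<in> words q" if "\<delta> \<in> nodes n" for \<delta>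
    using that n(2) by (auto simp: nodes_def words_def)
  have "sum w T + sum w R = sum w (nodes n)"
    unfolding R_def using sum.subset_diff[of T "nodes n" w] finite_nodes[of n] by (auto simp: T_def)
  also have "\<dots> = 1" unfolding w_def by (rule sum_weight) simp
  finally have TR: "sum w T + sum w R = 1" .
  have "w \<delta> \<le> (1 + \<epsilon>) * g (C [] \<delta>)" if "\<delta> \<in> T" for \<delta>
  proof -
    have len: "length \<delta> = n" using that by (simp add: T_def nodes_def)
    let ?s = "(\<xi> + of_int (K * C [] \<delta>)) / real b ^ n"
    have "1 / (1 + \<epsilon>) \<le> H ?s" using \<eta>(2)[of ?s] n(3)[of "C [] \<delta>"] that by (simp add: T_def)
    then have "w \<delta> * (1 / (1 + \<epsilon>)) \<le> w \<delta> * H ?s"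
      by (intro mult_left_mono) (simp_all add: w_def weight_nonneg)
    also have "\<dots> = g (C [] \<delta>)" using H_split[of \<xi> "[]" \<delta> 0] by (simp add: g_def w_def len)
    finally show ?thesis using \<epsilon> by (simp add: field_simps)
  qed
  then have "sum w T \<le> (\<Sum>\<delta>\<in>T. (1 + \<epsilon>) * g (C [] \<delta>))" by (rule sum_mono)
  also have "\<dots> = (1 + \<epsilon>) * sum g (C [] ` T)"
    by (subst sum.reindex) (auto simp: sum_distrib_left T_def intro!: inj_onI C_inj)
  also have "\<dots> \<le> (1 + \<epsilon>) * sum g G"
    using \<epsilon> G(1) by (intro mult_left_mono sum_mono2) (auto simp: T_def g_def H_nonneg)
  finally have "sum w R \<ge> 1 - (1 + \<epsilon>) * sum g G" using TR by linarith
  have "\<exists>\<omega>. set \<omega> \<subseteq> {..<q} \<and> terminal \<tau> (\<delta> @ \<omega>) \<and> c * w \<delta> \<le> g (C [] (\<delta> @ \<omega>))" if "\<delta> \<in> R" for \<delta>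
  proof -
    have \<delta>: "\<delta> \<in> nodes n" "length \<delta> = n" using that by (auto simp: R_def nodes_def)
    let ?s = "(\<xi> + of_int (K * C [] \<delta>)) / real b ^ length \<delta>"
    have "\<bar>?s\<bar> \<le> M" using \<delta> by (intro state_bound[OF \<xi> M]) (auto simp: nodes_def)
    from reach[OF nodes_words[OF \<delta>(1)] this] obtain \<omega> where
      \<omega>: "set \<omega> \<subseteq> {..<q}" "terminal \<tau> (\<delta> @ \<omega>)" "c \<le> H (?s + of_int (K * C \<delta> \<omega>))"
      unfolding reaches_def by blast
    have "c * w \<delta> \<le> H (?s + of_int (K * C \<delta> \<omega>)) * w \<delta>"
      by (intro mult_right_mono \<omega>(3)) (simp add: w_def weight_nonneg)
    also have "\<dots> = g (C [] (\<delta> @ \<omega>))"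
      using H_split[of \<xi> "[]" \<delta> "C \<delta> \<omega>"] by (simp add: g_def w_def digit_value_append mult.commute)
    finally show ?thesis using \<omega> by blast
  qed
  then obtain \<omega> where \<omega>: "\<And>\<delta>. \<delta> \<in> R \<Longrightarrow> set (\<omega> \<delta>) \<subseteq> {..<q}"
    "\<And>\<delta>. \<delta> \<in> R \<Longrightarrow> terminal \<tau> (\<delta> @ \<omega> \<delta>)" "\<And>\<delta>. \<delta> \<in> R \<Longrightarrow> c * w \<delta> \<le> g (C [] (\<delta> @ \<omega> \<delta>))"
    by metis
  define f where "f \<delta> = C [] (\<delta> @ \<omega> \<delta>)" for \<delta>
  \<comment> \<open>Equal values mean equal paths up to trailing zeros, so different nodes of level
    n lead to different values. Both the injectivity of \<open>f\<close> and its avoidance of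
    \<open>G\<close> rest on this.\<close>
  have same: "\<delta> = \<epsilon>" if "\<delta> \<in> nodes n" "\<epsilon> \<in> nodes n" "terminal \<tau> (\<delta> @ u)" "terminal \<tau> (\<epsilon> @ v)"
    "set u \<subseteq> {..<q}" "set v \<subseteq> {..<q}" "C [] (\<delta> @ u) = C [] (\<epsilon> @ v)" for \<delta> \<epsilon> u v
    using terminal_eq_up_to_zeros[of "\<delta> @ u" "\<epsilon> @ v"] that by (auto simp: nodes_def)
  have inj: "inj_on f R"
    by (intro inj_onI same[of _ _ "\<omega> _" "\<omega> _"]) (use \<omega> in \<open>auto simp: f_def R_def\<close>)
  have disj: "G \<inter> f ` R = {}"
  proof (rule ccontr)
    assume "G \<inter> f ` R \<noteq> {}"
    then obtain \<delta> where \<delta>: "\<delta> \<in> R" "f \<delta> \<in> G" by blast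
    obtain \<epsilon> where \<epsilon>: "\<epsilon> \<in> nodes n" "terminal \<tau> \<epsilon>" "C [] \<epsilon> = f \<delta>" using N[OF n(1) \<delta>(2)] by blast
    have "\<delta> = \<epsilon>"
      using same[of \<delta> \<epsilon> "\<omega> \<delta>" "[]"] \<delta> \<epsilon> \<omega> by (auto simp: R_def f_def)
    then show False using \<delta> \<epsilon> by (auto simp: R_def T_def)
  qed
  have "c * (1 - (1 + \<epsilon>) * sum g G) \<le> c * sum w R"
    using c \<open>sum w R \<ge> _\<close> by (intro mult_left_mono) auto
  also have "\<dots> \<le> (\<Sum>\<delta>\<in>R. g (f \<delta>))" unfolding sum_distrib_left f_def by (intro sum_mono \<omega>(3))
  also have "\<dots> = sum g (f ` R)" using inj by (simp add: sum.reindex)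
  finally have "sum g G + c * (1 - (1 + \<epsilon>) * sum g G) \<le> sum g (G \<union> f ` R)"
    using G(1) fin(2) disj by (simp add: sum.union_disjoint)
  moreover have "f ` R \<subseteq> leaf_values"
  proof
    fix v assume "v \<in> f ` R"
    then obtain \<delta> where \<delta>: "\<delta> \<in> R" "v = C [] (\<delta> @ \<omega> \<delta>)" by (auto simp: f_def)
    have "\<delta> \<in> words q" using \<delta>(1) by (intro nodes_words) (simp add: R_def)
    then have "\<delta> @ \<omega> \<delta> \<in> words q" using \<omega>(1)[OF \<delta>(1)] by (auto simp: words_def)
    then show "v \<in> leaf_values" using \<omega>(2)[OF \<delta>(1)] \<delta>(2) unfolding leaf_values_def by blast
  qed
  ultimately show ?thesis using G fin(2) by (intro exI[of _ "G \<union> f ` R"]) auto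
qed

text \<open>Bessel's inequality for the exponential of frequency - \<xi>.\<close>

lemma sum_leaf_values_le_1:
  assumes orth: "orthogonal_set (cantor_measure q b) \<Lambda>" and G: "finite G" "G \<subseteq> leaf_values"
  shows "(\<Sum>v\<in>G. H (\<xi> + of_int (K * v))) \<le> 1"
proof -
  interpret real_distribution "cantor_measure q b" by (rule real_distribution_cantor[OF q1 b2])
  let ?F = "(\<lambda>v. of_int (K * v)) ` G"
  have F: "?F \<subseteq> \<Lambda>" using G(2) unfolding Lambda_conv_leaf_values by blast
  have orthF: "L2_inner (cantor_measure q b) (expo l) (expo l') = 0" if "l \<in> ?F" "l' \<in> ?F" "l \<noteq> l'" for l l'
  proof -
    have "\<forall>l\<in>\<Lambda>. \<forall>l'\<in>\<Lambda>. l \<noteq> l' \<longrightarrow> L2_inner (cantor_measure q b) (expo l) (expo l') = 0"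
      using orth unfolding orthogonal_set_def by (rule conjunct2)
    from this[rule_format, OF subsetD[OF F that(1)] subsetD[OF F that(2)] that(3)] show ?thesis .
  qed
  have inj: "inj_on (\<lambda>v. real_of_int (K * v)) G"
    by (rule inj_onI) (simp add: K_nonzero)
  have "0 \<le> (\<integral>x. (cmod (expo (- \<xi>) x
      - (\<Sum>l\<in>?F. L2_inner (cantor_measure q b) (expo (- \<xi>)) (expo l) * expo l x)))\<^sup>2 \<partial>cantor_measure q b)"
    by (rule Bochner_Integration.integral_nonneg) (rule zero_le_power2)
  also have "\<dots> = 1 - (\<Sum>l\<in>?F. (cmod (L2_inner (cantor_measure q b) (expo (- \<xi>)) (expo l)))\<^sup>2)"
    by (rule integral_expo_projection[OF finite_imageI[OF G(1)] orthF])
  also have "(\<Sum>l\<in>?F. (cmod (L2_inner (cantor_measure q b) (expo (- \<xi>)) (expo l)))\<^sup>2)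
      = (\<Sum>v\<in>G. H (\<xi> + of_int (K * v)))"
    unfolding sum.reindex[OF inj] L2_inner_cantor cantor_hat_sq_def
    by (intro sum.cong refl) (simp add: add.commute)
  finally show ?thesis by simp
qed

lemma parseval_if_maximal:
  assumes max: "maximal_orthogonal_set (cantor_measure q b) \<Lambda>" and D: "level_diff q \<tau> < \<infinity>"
    and "\<epsilon> > 0"
  shows "\<exists>G\<subseteq>leaf_values. finite G \<and> 1 - \<epsilon> < (\<Sum>v\<in>G. H (\<xi> + of_int (K * v)))"
proof -
  \<comment> \<open>The interval must contain the initial state \<xi> and be invariant. That
    \<open>c\<close> then depends on \<xi> is harmless, as the supremum is studied for one \<xi> at
    a time.\<close>
  define M where "M = max \<bar>\<xi>\<bar> (2 * \<bar>real_of_int K\<bar>)"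
  have M: "M \<ge> 2 * \<bar>real_of_int K\<bar>" "\<bar>\<xi>\<bar> \<le> M" by (auto simp: M_def)
  obtain c where c: "c > 0" "c \<le> 1" "\<And>\<delta> x. \<delta> \<in> words q \<Longrightarrow> \<bar>x\<bar> \<le> M \<Longrightarrow> reaches c \<delta> x"
    using reaches_uniformly[OF max D M(1)] by blast
  define g where "g v = H (\<xi> + of_int (K * v))" for v
  define X where "X = {sum g G | G. finite G \<and> G \<subseteq> leaf_values}"
  have orth: "orthogonal_set (cantor_measure q b) \<Lambda>" using max by (simp add: maximal_orthogonal_set_def)
  have le1: "x \<le> 1" if "x \<in> X" for x
    using that sum_leaf_values_le_1[OF orth] unfolding X_def g_def by blast
  have ne: "X \<noteq> {}" unfolding X_def by (auto intro: exI[of _ "{}"])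
  have bdd: "bdd_above X" using le1 by (rule bdd_aboveI)
  have "Sup X \<ge> 1"
  proof (rule ccontr)
    assume "\<not> Sup X \<ge> 1"
    define d where "d = 1 - Sup X"
    have d: "d > 0" using \<open>\<not> Sup X \<ge> 1\<close> by (simp add: d_def)
    \<comment> \<open>The sum over G loses at most c d / 4 against the supremum, and the tolerance d
      / 4 costs at most another c d / 4, whereas the improvement is worth c d. The new sum therefore
      exceeds the supremum.\<close>
    have "Sup X - c * d / 4 < Sup X" using c d by simp
    then obtain x where "x \<in> X" "Sup X - c * d / 4 < x" using less_cSup_iff[OF ne bdd] by blast
    then obtain G where G: "finite G" "G \<subseteq> leaf_values" "Sup X - c * d / 4 < sum g G"
      unfolding X_def by blast
    have S: "sum g G \<le> Sup X" using G bdd unfolding X_def by (intro cSup_upper) auto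
    obtain G' where G': "finite G'" "G' \<subseteq> leaf_values"
      "sum g G + c * (1 - (1 + d / 4) * sum g G) \<le> sum g G'"
      using sum_improvable[OF c(1,3) M G(1,2), of "d / 4"] d unfolding g_def by auto
    have "sum g G \<le> 1" using S \<open>\<not> Sup X \<ge> 1\<close> by simp
    then have "d / 4 * sum g G \<le> d / 4 * 1" using d by (intro mult_left_mono) auto
    moreover have "(1 + d / 4) * sum g G = sum g G + d / 4 * sum g G" by (simp only: distrib_right mult_1_left)
    ultimately have "1 - (1 + d / 4) * sum g G \<ge> d - d / 4"
      using S d_def by linarith
    then have "c * (1 - (1 + d / 4) * sum g G) \<ge> c * (d - d / 4)"
      using c by (intro mult_left_mono) auto
    then have "sum g G' > Sup X"
      using G(3) G'(3) mult_pos_pos[OF c(1) d] by (simp add: algebra_simps)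
    moreover have "sum g G' \<le> Sup X" using G' bdd unfolding X_def by (intro cSup_upper) auto
    ultimately show False by simp
  qed
  then have "1 - \<epsilon> < Sup X" using \<open>\<epsilon> > 0\<close> by simp
  then obtain x where "x \<in> X" "1 - \<epsilon> < x" using less_cSup_iff[OF ne bdd] by blast
  then show ?thesis unfolding X_def g_def by blast
qed

lemma is_spectrum_if_maximal:
  assumes max: "maximal_orthogonal_set (cantor_measure q b) \<Lambda>" and D: "level_diff q \<tau> < \<infinity>"
  shows "is_spectrum (cantor_measure q b) \<Lambda>"
proof -
  interpret real_distribution "cantor_measure q b" by (rule real_distribution_cantor[OF q1 b2])
  show ?thesis
  proof (rule is_spectrumI)
    show "orthogonal_set (cantor_measure q b) \<Lambda>" using max by (simp add: maximal_orthogonal_set_def)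
    show "AE x in cantor_measure q b. \<bar>x\<bar> \<le> 2" by (rule AE_cantor_measure_bounded[OF q1 b4])
    fix t \<epsilon> :: real assume "\<epsilon> > 0"
    then obtain G where G: "G \<subseteq> leaf_values" "finite G" "1 - \<epsilon> < (\<Sum>v\<in>G. H (- t + of_int (K * v)))"
      using parseval_if_maximal[OF max D] by blast
    have inj: "inj_on (\<lambda>v. real_of_int (K * v)) G"
      by (rule inj_onI) (simp add: K_nonzero)
    have "(\<Sum>l\<in>(\<lambda>v. of_int (K * v)) ` G. (cmod (char (cantor_measure q b) (2 * pi * (l - t))))\<^sup>2)
        = (\<Sum>v\<in>G. H (- t + of_int (K * v)))"
      unfolding sum.reindex[OF inj] cantor_hat_sq_def
      by (intro sum.cong refl) (simp add: add.commute)
    then show "\<exists>F\<subseteq>\<Lambda>. finite F \<and>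
        1 - \<epsilon> < (\<Sum>l\<in>F. (cmod (char (cantor_measure q b) (2 * pi * (l - t))))\<^sup>2)"
      using G unfolding Lambda_conv_leaf_values by (intro exI[of _ "(\<lambda>v. of_int (K * v)) ` G"]) auto
  qed simp
qed

end

theorem theorem2p6:
  fixes q b :: nat and \<tau> :: "nat list \<Rightarrow> int" and K :: int
  assumes "q \<ge> 2" and "q dvd b" and "b div q \<ge> 2"
    and "maximal_tree_mapping q b \<tau>"
    and "level_diff q \<tau> < \<infinity>"
    and "coprime K (int b)"
  shows "is_spectrum (cantor_measure q b) ((\<lambda>x. of_int K * x) ` tree_Lambda q b \<tau>)
     \<longleftrightarrow> maximal_orthogonal_set (cantor_measure q b) ((\<lambda>x. of_int K * x) ` tree_Lambda q b \<tau>)"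
proof -
  interpret cantor_tree q b \<tau> K
    using assms by unfold_locales (simp_all add: maximal_tree_mapping_def)
  interpret real_distribution "cantor_measure q b" by (rule real_distribution_cantor[OF q1 b2])
  show ?thesis
    using is_spectrum_imp_maximal_orthogonal_set is_spectrum_if_maximal assms(5) by blast
qed

end
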